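(* Let $Q=\Bbbk[x_1,\dots,x_n]$ be a polynomial ring over a field $\Bbbk$, let $I=\langle m_1,\dots,m_r\rangle\subseteq Q$ be a monomial ideal with monomial generators $m_1,\dots,m_r$, and let $a_1,\dots,a_c\in Q$ be a regular sequence with $\mathfrak a=\langle a_1,\dots,a_c\rangle\subseteq I$. Fix polynomials $f_{i,j}\in Q$ ($i\in[c]$, $j\in[r]$) with $a_i=\sum_{j=1}^r f_{i,j}m_j$ for each $i$. Let $\mathbf T$ be the Taylor complex of $Q/I$ and define maps $\sigma_{\mathbf u}$ on $\mathbf T$, for $\mathbf u\in\mathbb N^c$, by: $\sigma_{\mathbf 0}=\tau$ (the Taylor differential); for each $i\in[c]$ and $S=\{s_1<\dots<s_k\}\subseteq[r]$, \[\sigma_{\mathbf e_i}(\varepsilon_S)=\sum_{t\in[r]\setminus S}(-1)^{k-p_{t,S}-1}\frac{f_{i,t}\,m_t\,m_S}{m_{S\cup\{t\}}}\,\varepsilon_{S\cup\{t\}},\] where $p_{t,S}$ is the position of $t$ in the increasingly ordered set $S\cup\{t\}$; and $\sigma_{\mathbf u}=0$ whenever $|\mathbf u|\ge 2$. Then: (1) $\{\sigma_{\mathbf u}\}$ is a system of higher homotopies for $a_1,\dots,a_c$ on $\mathbf T$; explicitly, $\sigma_{\mathbf e_i}\sigma_{\mathbf e_i}=0$ for all $i$, $\sigma_{\mathbf e_i}\sigma_{\mathbf e_j}+\sigma_{\mathbf e_j}\sigma_{\mathbf e_i}=0$ for all $i\neq j$, and $\tau\sigma_{\mathbf e_j}+\sigma_{\mathbf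 e_j}\tau$ is multiplication by $a_j$ on $\mathbf T$ for every $j$. (2) Consequently, with $R=Q/\mathfrak a$, the Eisenbud–Shamash complex $\Phi(\mathbf T)$ built from these maps is a free resolution of $R/I$ over $R$.
   Context: Notation: $[r]=\{1,\dots,r\}$. For $S=\{j_1,\dots,j_k\}\subseteq[r]$, $m_S=\operatorname{lcm}(m_{j_1},\dots,m_{j_k})$ (with $m_\emptyset=1$), and $v_S=\deg m_S$. The Taylor complex $\mathbf T$ of $Q/I$ has $T_k=\bigoplus_{S\subseteq[r],|S|=k}Q(-v_S)$ with basis elements $\varepsilon_S$, and differential $\tau(\varepsilon_S)=\sum_{i=1}^k(-1)^{k-i}\frac{m_S}{m_{S\setminus\{s_i\}}}\varepsilon_{S\setminus\{s_i\}}$ for $S=\{s_1<\dots<s_k\}$; it is a free resolution of $Q/I$ over $Q$. For $\mathbf u=(u_1,\dots,u_c)\in\mathbb N^c$, $|\mathbf u|=\sum u_i$, $\mathbf e_i$ is the $i$th standard basis vector and $\mathbf 0$ the zero vector. A system of higher homotopies for $a_1,\dots,a_c$ on a complex $\mathbf G$ of free $Q$-modules is a family of $Q$-linear maps $\sigma_{\mathbf u}:\mathbf G\to\mathbf G[-2|\mathbf u|+1]$ (raising homological degree by $2|\mathbf u|-1$), $\mathbf u\in\mathbb N^c$, such that (i) $\sigma_{\mathbf 0}$ is the differential of $\mathbf G$; (ii) for each $j\in[c]$, $\sigma_{\mathbf 0}\sigma_{\mathbf e_j}+\sigma_{\mathbf e_j}\sigma_{\mathbf 0}$ is multiplication by $a_j$;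 (iii) for every $\mathbf u$ with $|\mathbf u|\ge2$, $\sum_{\mathbf b+\mathbf b'=\mathbf u}\sigma_{\mathbf b}\sigma_{\mathbf b'}=0$. Eisenbud–Shamash construction: $\Phi(\mathbf G)=Q\{y_1,\dots,y_c\}\otimes_Q\mathbf G\otimes_Q R$, where $Q\{y_1,\dots,y_c\}$ is the divided power algebra with free basis $y^{(\mathbf u)}=y_1^{(u_1)}\cdots y_c^{(u_c)}$, each $y_i$ of homological degree 2 (so $y^{(\mathbf u)}\otimes g$ has degree $2|\mathbf u|+\deg g$), and the differential is $\varphi=\sum_{\mathbf u}t^{\mathbf u}\otimes\sigma_{\mathbf u}\otimes R$, where $t_j$ acts by $t_j y_j^{(p)}=y_j^{(p-1)}$ (and $t_jy_j^{(0)}=0$). In the present case $\varphi(y^{(\mathbf u)}\otimes\varepsilon_S)=y^{(\mathbf u)}\otimes\tau(\varepsilon_S)+\sum_{i:u_i\ge1}y^{(\mathbf u-\mathbf e_i)}\otimes\sigma_{\mathbf e_i}(\varepsilon_S)$, reduced modulo $\mathfrak a$. *)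

theory Defs
  imports "HOL-Library.Poly_Mapping"
begin

text \<open>Exponent vectors (variable x_(v+1) is indexed by v); polynomials are finitely
  supported maps from exponent vectors to coefficients. Q = k[x_1..x_n] is the
  subring Qn n of polynomials involving only variables with index < n.\<close>

type_synonym expo = "nat \<Rightarrow>\<^sub>0 nat"
type_synonym 'k mpoly = "expo \<Rightarrow>\<^sub>0 'k"

definition Qn :: "nat \<Rightarrow> 'k::field mpoly set" where
  "Qn n = {p. \<forall>e \<in> Poly_Mapping.keys p. Poly_Mapping.keys (e::expo) \<subseteq> {..<n}}"

definition mono :: "expo \<Rightarrow> 'k::field mpoly" where
  "mono e = Poly_Mapping.single e 1"

definition gen_ideal :: "nat \<Rightarrow> nat set \<Rightarrow> (nat \<Rightarrow> 'k::field mpoly) \<Rightarrow> 'k mpoly set" where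
  "gen_ideal n J g = {x. \<exists>h. (\<forall>j\<in>J. h j \<in> Qn n) \<and> x = (\<Sum>j\<in>J. h j * g j)}"

definition regular_seq :: "nat \<Rightarrow> nat \<Rightarrow> (nat \<Rightarrow> 'k::field mpoly) \<Rightarrow> bool" where
  "regular_seq n c a \<longleftrightarrow>
     (\<forall>i\<in>{1..c}. \<forall>x\<in>Qn n. a i * x \<in> gen_ideal n {1..<i} a \<longrightarrow> x \<in> gen_ideal n {1..<i} a) \<and>
     1 \<notin> gen_ideal n {1..c} a"

definition lcm_exp :: "(nat \<Rightarrow> expo) \<Rightarrow> nat set \<Rightarrow> expo" where
  "lcm_exp \<alpha> S = Abs_poly_mapping (\<lambda>v. Max (insert 0 ((\<lambda>j. Poly_Mapping.lookup (\<alpha> j) v) ` S)))"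

definition pos :: "nat set \<Rightarrow> nat \<Rightarrow> nat" where
  "pos S t = card {s\<in>S. s < t} + 1"

definition neg1pow :: "int \<Rightarrow> 'a::comm_ring_1" where
  "neg1pow k = (if even k then 1 else -1)"

text \<open>Q-linear maps on T are given by matrices: M S T is the coefficient of
  eps_T in the image of eps_S (basis indexed by subsets S of [r]).\<close>

definition taylor_diff :: "(nat \<Rightarrow> expo) \<Rightarrow> nat \<Rightarrow> nat set \<Rightarrow> nat set \<Rightarrow> 'k::field mpoly" where
  "taylor_diff \<alpha> r S T = (if S \<subseteq> {1..r} then
     (\<Sum>s\<in>S. if T = S - {s} then
         neg1pow (int (card S) - int (pos S s)) * mono (lcm_exp \<alpha> S - lcm_exp \<alpha> (S - {s}))
       else 0)
   else 0)"

definition sigma_e :: "(nat \<Rightarrow> expo) \<Rightarrow> (nat \<Rightarrow> nat \<Rightarrow> 'k::field mpoly) \<Rightarrow> nat \<Rightarrow> nat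
    \<Rightarrow> nat set \<Rightarrow> nat set \<Rightarrow> 'k mpoly" where
  "sigma_e \<alpha> f r i S T = (if S \<subseteq> {1..r} then
     (\<Sum>t\<in>{1..r} - S. if T = insert t S then
         neg1pow (int (card S) - int (pos S t) - 1) * f i t
           * mono (\<alpha> t + lcm_exp \<alpha> S - lcm_exp \<alpha> (insert t S))
       else 0)
   else 0)"

definition Nc :: "nat \<Rightarrow> (nat \<Rightarrow> nat) set" where
  "Nc c = {u. \<forall>i. i \<notin> {1..c} \<longrightarrow> u i = 0}"

definition absu :: "nat \<Rightarrow> (nat \<Rightarrow> nat) \<Rightarrow> nat" where
  "absu c u = (\<Sum>i\<in>{1..c}. u i)"

definition unit_vec :: "nat \<Rightarrow> nat \<Rightarrow> nat" where
  "unit_vec i = (\<lambda>j. if j = i then 1 else 0)"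

definition sigma_sys :: "(nat \<Rightarrow> expo) \<Rightarrow> (nat \<Rightarrow> nat \<Rightarrow> 'k::field mpoly) \<Rightarrow> nat \<Rightarrow> nat
    \<Rightarrow> (nat \<Rightarrow> nat) \<Rightarrow> nat set \<Rightarrow> nat set \<Rightarrow> 'k mpoly" where
  "sigma_sys \<alpha> f r c u = (if u = (\<lambda>_. 0) then taylor_diff \<alpha> r
     else if (\<exists>i\<in>{1..c}. u = unit_vec i)
       then sigma_e \<alpha> f r (THE i. i \<in> {1..c} \<and> u = unit_vec i)
     else (\<lambda>S T. 0))"

definition comp :: "'b set \<Rightarrow> ('b \<Rightarrow> 'b \<Rightarrow> 'k::field mpoly) \<Rightarrow> ('b \<Rightarrow> 'b \<Rightarrow> 'k mpoly)
    \<Rightarrow> 'b \<Rightarrow> 'b \<Rightarrow> 'k mpoly" where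
  "comp B F G = (\<lambda>S T. \<Sum>S'\<in>B. G S S' * F S' T)"

text \<open>G is a complex of free Q-modules with finite basis B, homological degree deg,
  and differential d (as a matrix).\<close>
definition is_HHS :: "nat \<Rightarrow> nat \<Rightarrow> (nat \<Rightarrow> 'k::field mpoly) \<Rightarrow> 'b set \<Rightarrow> ('b \<Rightarrow> nat)
    \<Rightarrow> ('b \<Rightarrow> 'b \<Rightarrow> 'k mpoly) \<Rightarrow> ((nat \<Rightarrow> nat) \<Rightarrow> 'b \<Rightarrow> 'b \<Rightarrow> 'k mpoly) \<Rightarrow> bool" where
  "is_HHS n c a B deg d \<sigma> \<longleftrightarrow>
     (\<forall>u\<in>Nc c. \<forall>S\<in>B. \<forall>T. \<sigma> u S T \<noteq> 0 \<longrightarrow>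
        T \<in> B \<and> int (deg T) = int (deg S) + 2 * int (absu c u) - 1 \<and> \<sigma> u S T \<in> Qn n) \<and>
     (\<forall>S\<in>B. \<forall>T. \<sigma> (\<lambda>_. 0) S T = d S T) \<and>
     (\<forall>j\<in>{1..c}. \<forall>S\<in>B. \<forall>T.
        comp B (\<sigma> (\<lambda>_. 0)) (\<sigma> (unit_vec j)) S T + comp B (\<sigma> (unit_vec j)) (\<sigma> (\<lambda>_. 0)) S T
          = (if T = S then a j else 0)) \<and>
     (\<forall>u\<in>Nc c. 2 \<le> absu c u \<longrightarrow> (\<forall>S\<in>B. \<forall>T.
        (\<Sum>b\<in>{b\<in>Nc c. \<forall>i. b i \<le> u i}. comp B (\<sigma> b) (\<sigma> (\<lambda>i. u i - b i)) S T) = 0))"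

text \<open>Basis y^(u) \<otimes> eps_S of Phi(T) in homological degree dd.\<close>
definition ES_basis :: "nat \<Rightarrow> nat \<Rightarrow> nat \<Rightarrow> ((nat \<Rightarrow> nat) \<times> nat set) set" where
  "ES_basis r c dd = {(u, S). u \<in> Nc c \<and> S \<subseteq> {1..r} \<and> 2 * absu c u + card S = dd}"

text \<open>phi = sum_w t^w \<otimes> sigma_w (coefficients taken in Q, to be read modulo the ideal a).\<close>
definition ES_diff :: "((nat \<Rightarrow> nat) \<Rightarrow> nat set \<Rightarrow> nat set \<Rightarrow> 'k::field mpoly)
    \<Rightarrow> (nat \<Rightarrow> nat) \<times> nat set \<Rightarrow> (nat \<Rightarrow> nat) \<times> nat set \<Rightarrow> 'k mpoly" where
  "ES_diff \<sigma> B B' = (case B of (u, S) \<Rightarrow> case B' of (v, T) \<Rightarrow>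
      if (\<forall>i. v i \<le> u i) then \<sigma> (\<lambda>i. u i - v i) S T else 0)"

text \<open>Elements of Phi(T)_dd, represented by coefficient vectors in Q.\<close>
definition ES_chain :: "nat \<Rightarrow> nat \<Rightarrow> nat \<Rightarrow> nat \<Rightarrow> ((nat \<Rightarrow> nat) \<times> nat set \<Rightarrow> 'k::field mpoly) \<Rightarrow> bool" where
  "ES_chain n r c dd x \<longleftrightarrow> (\<forall>B. (B \<notin> ES_basis r c dd \<longrightarrow> x B = 0) \<and> x B \<in> Qn n)"

definition ES_apply :: "nat \<Rightarrow> nat \<Rightarrow> nat
    \<Rightarrow> ((nat \<Rightarrow> nat) \<times> nat set \<Rightarrow> (nat \<Rightarrow> nat) \<times> nat set \<Rightarrow> 'k::field mpoly)
    \<Rightarrow> ((nat \<Rightarrow> nat) \<times> nat set \<Rightarrow> 'k mpoly) \<Rightarrow> (nat \<Rightarrow> nat) \<times> nat set \<Rightarrow> 'k mpoly" where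
  "ES_apply r c dd \<phi> x = (\<lambda>B'. \<Sum>B\<in>ES_basis r c dd. x B * \<phi> B B')"

end

theory Submission
  imports Defs
begin

text \<open>The identities of (1) are sign bookkeeping once every map is written as "adding one element"
  (or its transpose), with sign \<open>(-1)\<close> to the number of larger elements.

  For (2), write \<open>D\<^sub>k\<close> for the differential that uses only the first \<open>k\<close> homotopies, \<open>s\<close> for the
  homotopy of \<open>a = a\<^bsub>k+1\<^esub>\<close>, and \<open>t\<close> for the shift in the last direction, so that
  \<open>D\<^bsub>k+1\<^esub> = D\<^sub>k + t s\<close> and \<open>D\<^bsub>k+1\<^esub>\<^sup>2 = D\<^sub>k\<^sup>2 + a t\<close>. Work modulo \<open>(a\<^sub>1, \<dots>, a\<^sub>k)\<close>. If \<open>D\<^bsub>k+1\<^esub> x = a z\<close>,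
  applying \<open>D\<^bsub>k+1\<^esub>\<close> gives \<open>a t x = a D\<^bsub>k+1\<^esub> z\<close>, hence \<open>D\<^bsub>k+1\<^esub> z = t x\<close> because \<open>a\<close> is a non-zero-divisor.
  So any \<open>z'\<close> with \<open>t z' = z\<close> bounds \<open>x\<close> up to a \<open>D\<^sub>k\<close>-cycle of exponent 0 in the last direction, which
  is a boundary by induction. The induction starts with the acyclicity of the Taylor complex, which is
  contracted one multidegree at a time.\<close>

subsection \<open>Signs\<close>

text \<open>Counting larger elements is what both sign conventions, (-1)^(k-i) and (-1)^(k-p-1),
  come down to, and it makes the Taylor differential the exact transpose of a map shaped like the
  homotopies. All chains have coefficients in Q, and a statement over R is a congruence modulo
  \<open>gen_ideal\<close>. So D_k D_k is not zero but lies in the ideal, and this defect carries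
  the information used in the induction. The step from k to k+1 makes explicit the exact sequence
  with kernel Phi_k / a (exponent 0 in the last direction), middle term Phi_(k+1) and quotient map t
  onto the shifted Phi_(k+1). The kernel is not acyclic in positive degrees: a annihilates R/I, so
  reducing modulo a creates a copy of R/I in degree 1. The homotopy s has to cancel it. The quotient
  z of D x by a is the element that does so, and finding it by division avoids any induction on the
  homological degree.\<close>

definition sg :: "nat set \<Rightarrow> nat \<Rightarrow> 'a::comm_ring_1" where
  "sg S t = (-1) ^ card {u\<in>S. t < u}"

lemma sg_cong: "{u\<in>S. t < u} = {u\<in>S'. t < u} \<Longrightarrow> sg S t = sg S' t"
  by (simp add: sg_def)

lemma sg_insert_same [simp]: "sg (insert t S) t = sg S t"
  by (rule sg_cong) auto

lemma sg_remove_same [simp]: "sg (S - {t}) t = sg S t"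
  by (rule sg_cong) auto

lemma sg_sq [simp]: "sg S t * sg S t = (1::'a::comm_ring_1)"
  by (simp add: sg_def flip: power_add mult_2)

lemma sg_insert:
  assumes "finite S" "s \<notin> S" "s \<noteq> t"
  shows "sg (insert s S) t = (if t < s then - sg S t else sg S t)"
proof (cases "t < s")
  case True
  then have "{u\<in>insert s S. t < u} = insert s {u\<in>S. t < u}" by auto
  with True assms show ?thesis by (simp add: sg_def)
next
  case False
  then have "{u\<in>insert s S. t < u} = {u\<in>S. t < u}" by auto
  with False show ?thesis by (simp add: sg_def)
qed

text \<open>Only the smaller of \<open>s\<close> and \<open>t\<close> counts the other one as
  larger, so exactly one of the two signs changes with the order of insertion.\<close>

lemma sg_swap:
  assumes "finite S" "s \<notin> S" "t \<notin> S" "s \<noteq> t"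
  shows "sg S t * sg (insert t S) s = - (sg S s * sg (insert s S) t :: 'a::comm_ring_1)"
  using assms by (auto simp: sg_insert not_less)

text \<open>Deleting \<open>s\<close> changes the sign of \<open>t\<close> when
  \<open>t < s\<close>, and inserting \<open>t\<close> changes the sign of \<open>s\<close> when
  \<open>s < t\<close>; exactly one of these happens.\<close>

lemma sg_swap_remove:
  assumes "finite S" "s \<in> S" "t \<notin> S"
  shows "sg S t * sg (insert t S) s = - (sg S s * sg (S - {s}) t :: 'a::comm_ring_1)"
proof -
  have "sg S t = sg (insert s (S - {s})) t"
    using assms by (simp add: insert_absorb)
  also have "\<dots> = (if t < s then - sg (S - {s}) t else sg (S - {s}) t :: 'a)"
    by (rule sg_insert) (use assms in auto)
  finally have 1: "sg S t = (if t < s then - sg (S - {s}) t else sg (S - {s}) t :: 'a)" .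
  have 2: "sg (insert t S) s = (if s < t then - sg S s else sg S s :: 'a)"
    using assms by (intro sg_insert) auto
  from assms have "s \<noteq> t" by auto
  then show ?thesis using 1 2 by (auto simp: not_less)
qed

lemma card_pos: "finite S \<Longrightarrow> card S + 1 = pos S t + card {u\<in>S. t \<le> u}"
proof -
  assume f: "finite S"
  have "S = {u\<in>S. u < t} \<union> {u\<in>S. t \<le> u}" by auto
  then have "card S = card ({u\<in>S. u < t} \<union> {u\<in>S. t \<le> u})" by simp
  also have "\<dots> = card {u\<in>S. u < t} + card {u\<in>S. t \<le> u}"
    using f by (intro card_Un_disjoint) auto
  finally show ?thesis by (simp add: pos_def)
qed

lemma neg1pow_of_nat: "neg1pow (int k) = (-1) ^ k"
  by (simp add: neg1pow_def)

lemma neg1pow_mem: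
  assumes "finite S" "t \<in> S"
  shows "neg1pow (int (card S) - int (pos S t)) = sg S t"
proof -
  have "{u\<in>S. t \<le> u} = insert t {u\<in>S. t < u}" using assms by auto
  then have "card S = pos S t + card {u\<in>S. t < u}"
    using card_pos[OF assms(1), of t] assms(1) by simp
  then have "int (card S) - int (pos S t) = int (card {u\<in>S. t < u})" by simp
  then show ?thesis by (simp only: neg1pow_of_nat sg_def)
qed

text \<open>The position of \<open>t\<close> is the one in \<open>insert t S\<close>, so the
  exponent is two less than the number of larger elements. It may be negative, but
  \<open>neg1pow\<close> depends only on its parity.\<close>

lemma neg1pow_nonmem:
  assumes "finite S" "t \<notin> S"
  shows "neg1pow (int (card S) - int (pos S t) - 1) = (sg S t :: 'a::comm_ring_1)"
proof -
  have "{u\<in>S. t \<le> u} = {u\<in>S. t < u}" using assms le_less by blast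
  then have "card S + 1 = pos S t + card {u\<in>S. t < u}"
    using card_pos[OF assms(1), of t] by simp
  then have "int (card S) - int (pos S t) - 1 = int (card {u\<in>S. t < u}) - 2" by simp
  moreover have "neg1pow (k - 2) = (neg1pow k :: 'a::comm_ring_1)" for k by (simp add: neg1pow_def)
  ultimately show ?thesis by (simp only: neg1pow_of_nat sg_def)
qed

subsection \<open>Exponents\<close>

lemma lookup_minus_expo:
  "Poly_Mapping.lookup (a - b :: expo) v = Poly_Mapping.lookup a v - Poly_Mapping.lookup b v"
  by transfer simp

lemma lookup_lcm_exp:
  assumes "finite S"
  shows "Poly_Mapping.lookup (lcm_exp \<alpha> S) v
    = Max (insert 0 ((\<lambda>j. Poly_Mapping.lookup (\<alpha> j) v) ` S))"
proof -
  have "{v. Max (insert 0 ((\<lambda>j. Poly_Mapping.lookup (\<alpha> j) v) ` S)) \<noteq> 0}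
      \<subseteq> (\<Union>j\<in>S. Poly_Mapping.keys (\<alpha> j))"
  proof
    fix v assume "v \<in> {v. Max (insert 0 ((\<lambda>j. Poly_Mapping.lookup (\<alpha> j) v) ` S)) \<noteq> 0}"
    moreover have "Max (insert 0 ((\<lambda>j. Poly_Mapping.lookup (\<alpha> j) v) ` S))
      \<in> insert 0 ((\<lambda>j. Poly_Mapping.lookup (\<alpha> j) v) ` S)"
      using assms by (intro Max_in) auto
    ultimately show "v \<in> (\<Union>j\<in>S. Poly_Mapping.keys (\<alpha> j))"
      by (auto simp: in_keys_iff)
  qed
  then have "finite {v. Max (insert 0 ((\<lambda>j. Poly_Mapping.lookup (\<alpha> j) v) ` S)) \<noteq> 0}"
    by (rule finite_subset) (use assms in auto)
  then show ?thesis unfolding lcm_exp_def by simp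
qed

lemma lookup_lcm_exp_empty [simp]: "Poly_Mapping.lookup (lcm_exp \<alpha> {}) v = 0"
  by (simp add: lookup_lcm_exp)

lemma lookup_lcm_exp_insert:
  assumes "finite S"
  shows "Poly_Mapping.lookup (lcm_exp \<alpha> (insert t S)) v
    = max (Poly_Mapping.lookup (\<alpha> t) v) (Poly_Mapping.lookup (lcm_exp \<alpha> S) v)"
  using assms by (simp add: lookup_lcm_exp insert_commute[of 0])

lemma keys_lcm_exp:
  assumes "finite S" "\<And>j. j \<in> S \<Longrightarrow> Poly_Mapping.keys (\<alpha> j) \<subseteq> V"
  shows "Poly_Mapping.keys (lcm_exp \<alpha> S) \<subseteq> V"
  using assms
proof (induction S rule: finite_induct)
  case empty
  then show ?case by (auto simp: in_keys_iff)
next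
  case (insert t S)
  then have "Poly_Mapping.keys (lcm_exp \<alpha> S) \<subseteq> V" "Poly_Mapping.keys (\<alpha> t) \<subseteq> V" by auto
  moreover have "Poly_Mapping.keys (lcm_exp \<alpha> (insert t S))
      \<subseteq> Poly_Mapping.keys (\<alpha> t) \<union> Poly_Mapping.keys (lcm_exp \<alpha> S)"
    using insert.hyps by (auto simp: in_keys_iff lookup_lcm_exp_insert)
  ultimately show ?case by blast
qed

lemma mono_mult: "mono a * mono b = mono (a + b)"
  by (simp add: mono_def mult_single)

text \<open>The order of \<^typ>\<open>expo\<close> provided by the library is lexicographic, hence a separate relation for
  divisibility of monomials.\<close>
definition expo_le :: "expo \<Rightarrow> expo \<Rightarrow> bool" where
  "expo_le a b \<longleftrightarrow> (\<forall>v. Poly_Mapping.lookup a v \<le> Poly_Mapping.lookup b v)"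

lemma expo_le_add_diff: "expo_le a b \<Longrightarrow> a + (b - a) = b"
  by (rule poly_mapping_eqI) (simp add: expo_le_def lookup_add lookup_minus_expo)

lemma expo_le_add: "expo_le a (a + b)"
  by (simp add: expo_le_def lookup_add)

lemma expo_le_trans: "expo_le a b \<Longrightarrow> expo_le b c \<Longrightarrow> expo_le a c"
  unfolding expo_le_def using le_trans by blast

lemma expo_le_lcm_exp_iff:
  assumes "finite S"
  shows "expo_le (lcm_exp \<alpha> S) e \<longleftrightarrow> (\<forall>j\<in>S. expo_le (\<alpha> j) e)"
  using assms by (auto simp: lookup_lcm_exp expo_le_def)

lemma expo_le_lcm_exp_insert: "finite S \<Longrightarrow> expo_le (lcm_exp \<alpha> S) (lcm_exp \<alpha> (insert t S))"
  by (simp add: expo_le_def lookup_lcm_exp_insert)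

lemma lookup_mult_mono:
  "Poly_Mapping.lookup (p * mono k) b
    = (if expo_le k b then Poly_Mapping.lookup p (b - k) else 0)"
proof -
  have inner: "(\<Sum>q. Poly_Mapping.lookup (mono k) q when b = l + q) = (1 when b = l + k :: 'a)" for l
  proof -
    have "(\<Sum>q. Poly_Mapping.lookup (mono k) q when b = l + q) = (\<Sum>q. (1 when b = l + q :: 'a) when k = q)"
      unfolding mono_def lookup_single by (intro Sum_any.cong when_commute)
    then show ?thesis by simp
  qed
  have "Poly_Mapping.lookup (p * mono k) b = (\<Sum>l. Poly_Mapping.lookup p l when b = l + k)"
    unfolding lookup_mult inner by (intro Sum_any.cong) (simp add: when_def)
  also have "\<dots> = (if expo_le k b then Poly_Mapping.lookup p (b - k) else 0)"
  proof (cases "expo_le k b")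
    case True
    then have "b = l + k \<longleftrightarrow> l = b - k" for l
      using expo_le_add_diff[OF True] by (auto simp: add.commute)
    with True show ?thesis by simp
  next
    case False
    then have "b \<noteq> l + k" for l
      using expo_le_add[of k l] by (auto simp: add.commute)
    with False show ?thesis by simp
  qed
  finally show ?thesis .
qed

subsection \<open>The subring of polynomials in the first n variables\<close>

lemma Qn_zero [simp, intro]: "0 \<in> Qn n"
  by (simp add: Qn_def)

lemma Qn_one [simp, intro]: "1 \<in> Qn n"
  by (simp add: Qn_def)

lemma Qn_add [intro]: "p \<in> Qn n \<Longrightarrow> q \<in> Qn n \<Longrightarrow> p + q \<in> Qn n"
  using keys_add[of p q] by (fastforce simp: Qn_def)

lemma Qn_uminus [intro]: "p \<in> Qn n \<Longrightarrow> - p \<in> Qn n"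
  by (simp add: Qn_def in_keys_iff)

lemma Qn_diff [intro]: "p \<in> Qn n \<Longrightarrow> q \<in> Qn n \<Longrightarrow> p - q \<in> Qn n"
  using Qn_add[OF _ Qn_uminus, of p n q] by simp

lemma Qn_mult [intro]:
  assumes "p \<in> Qn n" "q \<in> Qn n"
  shows "p * q \<in> Qn n"
proof -
  have "Poly_Mapping.keys e \<subseteq> {..<n}" if "e \<in> Poly_Mapping.keys (p * q)" for e
  proof -
    from that keys_mult[of p q] obtain a b
      where ab: "e = a + b" "a \<in> Poly_Mapping.keys p" "b \<in> Poly_Mapping.keys q" by auto
    then show ?thesis using keys_add[of a b] assms by (fastforce simp: Qn_def)
  qed
  then show ?thesis by (simp add: Qn_def)
qed

lemma Qn_sum [intro]: "(\<And>i. i \<in> A \<Longrightarrow> p i \<in> Qn n) \<Longrightarrow> sum p A \<in> Qn n"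
  by (induction A rule: infinite_finite_induct) auto

lemma Qn_mono: "Poly_Mapping.keys e \<subseteq> {..<n} \<Longrightarrow> mono e \<in> Qn n"
  by (simp add: Qn_def mono_def)

lemma Qn_sg [simp, intro]: "sg S t \<in> Qn n"
proof -
  have "(-1) ^ k \<in> Qn n" for k by (induction k) auto
  then show ?thesis by (simp add: sg_def)
qed

subsection \<open>Maps given by adding one element\<close>

text \<open>The sign is kept apart from the coefficient \<open>g\<close>, so that commutation
  arguments only have to compare coefficients for two orders of insertion. The coefficient depends
  on \<open>S\<close>, as lcm quotients do.\<close>

definition raise :: "nat \<Rightarrow> (nat set \<Rightarrow> nat \<Rightarrow> 'k::field mpoly) \<Rightarrow> nat set \<Rightarrow> nat set \<Rightarrow> 'k mpoly" where
  "raise r g S T = (if S \<subseteq> {1..r} then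
     (\<Sum>t\<in>{1..r} - S. if T = insert t S then sg S t * g S t else 0) else 0)"

lemma raise_nonzeroD:
  assumes "raise r g S T \<noteq> 0"
  obtains t where "S \<subseteq> {1..r}" "t \<in> {1..r} - S" "T = insert t S"
proof -
  have S: "S \<subseteq> {1..r}" by (rule ccontr) (use assms in \<open>simp add: raise_def\<close>)
  with assms have "(\<Sum>t\<in>{1..r} - S. if T = insert t S then sg S t * g S t else 0) \<noteq> 0"
    by (simp add: raise_def)
  then obtain t where "t \<in> {1..r} - S" "(if T = insert t S then sg S t * g S t else 0) \<noteq> 0"
    by (rule sum.not_neutral_contains_not_neutral)
  with S that show ?thesis by (cases "T = insert t S") simp_all
qed

lemma raise_insert:
  assumes "S \<subseteq> {1..r}" "t \<in> {1..r} - S"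
  shows "raise r g S (insert t S) = sg S t * g S t"
proof -
  have "(\<Sum>t'\<in>{1..r} - S. if insert t S = insert t' S then sg S t' * g S t' else 0)
      = (\<Sum>t'\<in>{1..r} - S. if t = t' then sg S t' * g S t' else 0)"
    by (rule sum.cong) (use assms in auto)
  then show ?thesis using assms by (simp add: raise_def)
qed

lemma sum_raise:
  assumes "S \<subseteq> {1..r}"
  shows "(\<Sum>S'\<in>Pow {1..r}. raise r g S S' * F S')
    = (\<Sum>t\<in>{1..r} - S. sg S t * g S t * F (insert t S))"
proof -
  have "(\<Sum>S'\<in>Pow {1..r}. raise r g S S' * F S')
      = (\<Sum>S'\<in>Pow {1..r}. \<Sum>t\<in>{1..r} - S. if S' = insert t S then sg S t * g S t * F S' else 0)"
    using assms by (simp add: raise_def sum_distrib_right if_distrib[of "\<lambda>x. x * _"] cong: if_cong)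
  also have "\<dots> = (\<Sum>t\<in>{1..r} - S. \<Sum>S'\<in>Pow {1..r}. if S' = insert t S then sg S t * g S t * F S' else 0)"
    by (rule sum.swap)
  also have "\<dots> = (\<Sum>t\<in>{1..r} - S. sg S t * g S t * F (insert t S))"
    by (rule sum.cong) (use assms in \<open>auto simp: sum.delta\<close>)
  finally show ?thesis .
qed

text \<open>Exchanging the indices shows only that the sum is its own negative, which proves nothing
  in characteristic 2. Therefore the pairs are split by order and the two halves cancel term by
  term.\<close>

lemma sum_antisym:
  fixes K :: "nat \<Rightarrow> nat \<Rightarrow> 'a::ab_group_add"
  assumes "finite A" "\<And>s t. s \<in> A \<Longrightarrow> t \<in> A \<Longrightarrow> s \<noteq> t \<Longrightarrow> K t s = - K s t"
  shows "(\<Sum>t\<in>A. \<Sum>s\<in>A - {t}. K t s) = 0"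
proof -
  have "(\<Sum>t\<in>A. \<Sum>s\<in>A - {t}. K t s)
      = (\<Sum>t\<in>A. (\<Sum>s\<in>{s\<in>A. s < t}. K t s) + (\<Sum>s\<in>{s\<in>A. t < s}. K t s))"
  proof (rule sum.cong)
    fix t assume "t \<in> A"
    have "A - {t} = {s\<in>A. s < t} \<union> {s\<in>A. t < s}" by auto
    then show "(\<Sum>s\<in>A - {t}. K t s) = (\<Sum>s\<in>{s\<in>A. s < t}. K t s) + (\<Sum>s\<in>{s\<in>A. t < s}. K t s)"
      using assms(1) by (simp add: sum.union_disjoint disjoint_iff)
  qed simp
  also have "\<dots> = (\<Sum>t\<in>A. \<Sum>s\<in>{s\<in>A. s < t}. K t s) + (\<Sum>t\<in>A. \<Sum>s\<in>{s\<in>A. t < s}. K t s)"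
    by (rule sum.distrib)
  also have "(\<Sum>t\<in>A. \<Sum>s\<in>{s\<in>A. t < s}. K t s) = (\<Sum>s\<in>A. \<Sum>t\<in>{t\<in>A. t < s}. K t s)"
    using assms(1) by (intro sum.swap_restrict) auto
  also have "\<dots> = (\<Sum>s\<in>A. \<Sum>t\<in>{t\<in>A. t < s}. - K s t)"
    by (intro sum.cong refl assms(2)) auto
  finally show ?thesis by (simp add: sum_negf)
qed

text \<open>The sum over ordered pairs keeps the test on \<open>T\<close> inside, so that reversing
  the order of the two insertions simply exchanges two summands.\<close>

lemma comp_raise:
  assumes "S \<subseteq> {1..r}"
  shows "comp (Pow {1..r}) (raise r h) (raise r g) S T
    = (\<Sum>t\<in>{1..r} - S. \<Sum>s\<in>({1..r} - S) - {t}. if T = insert s (insert t S)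
         then sg S t * sg (insert t S) s * (g S t * h (insert t S) s) else 0)"
proof -
  have "comp (Pow {1..r}) (raise r h) (raise r g) S T
      = (\<Sum>t\<in>{1..r} - S. sg S t * g S t * raise r h (insert t S) T)"
    unfolding comp_def by (rule sum_raise[OF assms])
  also have "\<dots> = (\<Sum>t\<in>{1..r} - S. \<Sum>s\<in>({1..r} - S) - {t}. if T = insert s (insert t S)
         then sg S t * sg (insert t S) s * (g S t * h (insert t S) s) else 0)"
  proof (rule sum.cong)
    fix t assume t: "t \<in> {1..r} - S"
    have "{1..r} - insert t S = ({1..r} - S) - {t}" by auto
    then show "sg S t * g S t * raise r h (insert t S) T
      = (\<Sum>s\<in>({1..r} - S) - {t}. if T = insert s (insert t S)
         then sg S t * sg (insert t S) s * (g S t * h (insert t S) s) else 0)"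
      using assms t by (simp add: raise_def sum_distrib_left if_distrib[of "\<lambda>x. _ * x"] ac_simps cong: if_cong)
  qed simp
  finally show ?thesis .
qed

lemma comp_raise_self:
  assumes "S \<subseteq> {1..r}"
    and "\<And>s t. s \<notin> S \<Longrightarrow> t \<notin> S \<Longrightarrow> s \<noteq> t \<Longrightarrow> g S t * g (insert t S) s = g S s * g (insert s S) t"
  shows "comp (Pow {1..r}) (raise r g) (raise r g) S T = 0"
  unfolding comp_raise[OF assms(1)]
proof (rule sum_antisym)
  fix s t assume *: "s \<in> {1..r} - S" "t \<in> {1..r} - S" "s \<noteq> t"
  have "finite S" using assms(1) finite_subset by blast
  then show "(if T = insert s (insert t S) then sg S t * sg (insert t S) s * (g S t * g (insert t S) s) else 0)
    = - (if T = insert t (insert s S) then sg S s * sg (insert s S) t * (g S s * g (insert s S) t) else 0)"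
    using * assms(2)[of s t] sg_swap[of S s t, where ?'a = "'a mpoly"] by (simp add: insert_commute)
qed simp

text \<open>Only the combined summand is antisymmetric: adding \<open>t\<close> by \<open>h\<close>
  and then \<open>s\<close> by \<open>g\<close> cancels against adding \<open>s\<close> by
  \<open>g\<close> and then \<open>t\<close> by \<open>h\<close>, a term of the other
  composite.\<close>

lemma comp_raise_anticommute:
  assumes "S \<subseteq> {1..r}"
    and "\<And>s t. s \<notin> S \<Longrightarrow> t \<notin> S \<Longrightarrow> s \<noteq> t \<Longrightarrow> g S t * h (insert t S) s = h S s * g (insert s S) t"
  shows "comp (Pow {1..r}) (raise r g) (raise r h) S T
    + comp (Pow {1..r}) (raise r h) (raise r g) S T = 0"
  unfolding comp_raise[OF assms(1)] sum.distrib[symmetric]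
proof (rule sum_antisym)
  fix s t assume *: "s \<in> {1..r} - S" "t \<in> {1..r} - S" "s \<noteq> t"
  have "finite S" using assms(1) finite_subset by blast
  then show "(if T = insert s (insert t S) then sg S t * sg (insert t S) s * (h S t * g (insert t S) s) else 0)
    + (if T = insert s (insert t S) then sg S t * sg (insert t S) s * (g S t * h (insert t S) s) else 0)
    = - ((if T = insert t (insert s S) then sg S s * sg (insert s S) t * (h S s * g (insert s S) t) else 0)
      + (if T = insert t (insert s S) then sg S s * sg (insert s S) t * (g S s * h (insert s S) t) else 0))"
    using * assms(2)[of s t] assms(2)[of t s] sg_swap[of S s t, where ?'a = "'a mpoly"]
    by (simp add: insert_commute add.commute)
qed simp

subsection \<open>The Taylor differential and its homotopies\<close>

definition taylor_coef :: "(nat \<Rightarrow> expo) \<Rightarrow> nat set \<Rightarrow> nat \<Rightarrow> 'k::field mpoly" where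
  "taylor_coef \<alpha> S t = mono (lcm_exp \<alpha> (insert t S) - lcm_exp \<alpha> S)"

text \<open>The exponent is that of gcd(m_t, m_S) = m_t m_S / lcm(m_t, m_S), so the subtraction
  never truncates. The Taylor coefficient is the complementary factor m_t / gcd(m_t, m_S).\<close>

definition homotopy_coef :: "(nat \<Rightarrow> expo) \<Rightarrow> (nat \<Rightarrow> 'k::field mpoly) \<Rightarrow> nat set \<Rightarrow> nat \<Rightarrow> 'k mpoly" where
  "homotopy_coef \<alpha> g S t = g t * mono (\<alpha> t + lcm_exp \<alpha> S - lcm_exp \<alpha> (insert t S))"

lemma sigma_e_eq_raise: "sigma_e \<alpha> f r i = raise r (homotopy_coef \<alpha> (f i))"
proof (intro ext)
  fix S T
  show "sigma_e \<alpha> f r i S T = raise r (homotopy_coef \<alpha> (f i)) S T"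
  proof (cases "S \<subseteq> {1..r}")
    case True
    then have "finite S" using finite_subset by blast
    with True show ?thesis
      by (auto simp: sigma_e_def raise_def homotopy_coef_def neg1pow_nonmem mult.assoc intro!: sum.cong)
  qed (simp add: sigma_e_def raise_def)
qed

lemma taylor_diff_eq_sum:
  assumes "S \<subseteq> {1..r}"
  shows "taylor_diff \<alpha> r S T
    = (\<Sum>s\<in>S. if T = S - {s} then sg S s * taylor_coef \<alpha> (S - {s}) s else 0)"
proof -
  have "finite S" using assms finite_subset by blast
  then show ?thesis using assms
    by (auto simp: taylor_diff_def taylor_coef_def neg1pow_mem insert_absorb intro!: sum.cong)
qed

text \<open>Removing \<open>s\<close> from \<open>S\<close> undoes adding \<open>s\<close> to
  \<open>S - {s}\<close>, and \<open>s\<close> sees the same larger elements in both sets, so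
  transposing costs no sign.\<close>

lemma taylor_diff_eq_raise: "taylor_diff \<alpha> r S T = raise r (taylor_coef \<alpha>) T S"
  (is "?L = ?R")
proof (cases "\<exists>s\<in>S. S \<subseteq> {1..r} \<and> T = S - {s}")
  case True
  then obtain s where s: "s \<in> S" "S \<subseteq> {1..r}" "T = S - {s}" by blast
  then have fin: "finite S" using finite_subset by blast
  have "?L = (\<Sum>s'\<in>S. if s = s' then sg S s' * taylor_coef \<alpha> (S - {s'}) s' else 0)"
    unfolding taylor_diff_eq_sum[OF s(2)] using s by (intro sum.cong) auto
  also have "\<dots> = sg S s * taylor_coef \<alpha> T s" using fin s by simp
  also have "\<dots> = ?R"
  proof -
    have "raise r g T (insert s T) = sg T s * g T s" for g :: "nat set \<Rightarrow> nat \<Rightarrow> 'a mpoly"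
    proof (rule raise_insert)
      show "T \<subseteq> {1..r}" using s(2) unfolding s(3) by blast
      show "s \<in> {1..r} - T" using s(1,2) unfolding s(3) by blast
    qed
    moreover have "insert s T = S" using s(1) unfolding s(3) by (rule insert_Diff)
    moreover have "sg T s = (sg S s :: 'a mpoly)" unfolding s(3) by (rule sg_remove_same)
    ultimately show ?thesis by (simp only:)
  qed
  finally show ?thesis .
next
  case False
  then have "?L = 0"
    by (cases "S \<subseteq> {1..r}") (auto simp: taylor_diff_eq_sum taylor_diff_def intro!: sum.neutral)
  moreover have "?R = 0"
  proof (rule ccontr)
    assume "?R \<noteq> 0"
    then obtain t where "T \<subseteq> {1..r}" "t \<in> {1..r} - T" "S = insert t T" by (rule raise_nonzeroD)
    with False show False by auto
  qed
  ultimately show ?thesis by simp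
qed

text \<open>Transposing reverses composition, so \<open>T\<close> becomes the source of two
  insertions. In either order the lcm quotients telescope to the same monomial.\<close>

lemma comp_taylor_diff:
  assumes "T \<subseteq> {1..r}"
  shows "comp (Pow {1..r}) (taylor_diff \<alpha> r) (taylor_diff \<alpha> r) S T = 0"
proof -
  have "comp (Pow {1..r}) (taylor_diff \<alpha> r) (taylor_diff \<alpha> r) S T
      = comp (Pow {1..r}) (raise r (taylor_coef \<alpha>)) (raise r (taylor_coef \<alpha>)) T S"
    by (simp add: comp_def taylor_diff_eq_raise mult.commute)
  also have "\<dots> = 0"
  proof (rule comp_raise_self[OF assms])
    fix s t
    have fin: "finite T" using assms finite_subset by blast
    have "lcm_exp \<alpha> (insert t T) - lcm_exp \<alpha> T
        + (lcm_exp \<alpha> (insert s (insert t T)) - lcm_exp \<alpha> (insert t T))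
      = lcm_exp \<alpha> (insert s T) - lcm_exp \<alpha> T
        + (lcm_exp \<alpha> (insert t (insert s T)) - lcm_exp \<alpha> (insert s T))"
      by (rule poly_mapping_eqI, simp only: lookup_add lookup_minus_expo lookup_lcm_exp_insert fin finite_insert)
       linarith
    then show "taylor_coef \<alpha> T t * taylor_coef \<alpha> (insert t T) s
      = taylor_coef \<alpha> T s * taylor_coef \<alpha> (insert s T) t"
      by (simp add: taylor_coef_def mono_mult)
  qed
  finally show ?thesis .
qed

text \<open>Both orders give m_s m_t m_S divided by the lcm over
  \<open>insert s (insert t S)\<close>. With two families \<open>g\<close> and \<open>h\<close> the
  same fact serves squares and anticommutators.\<close>

lemma homotopy_coef_swap:
  assumes "finite S"
  shows "homotopy_coef \<alpha> g S t * homotopy_coef \<alpha> h (insert t S) s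
    = homotopy_coef \<alpha> h S s * homotopy_coef \<alpha> g (insert s S) t"
proof -
  have "(\<alpha> t + lcm_exp \<alpha> S - lcm_exp \<alpha> (insert t S))
      + (\<alpha> s + lcm_exp \<alpha> (insert t S) - lcm_exp \<alpha> (insert s (insert t S)))
    = (\<alpha> s + lcm_exp \<alpha> S - lcm_exp \<alpha> (insert s S))
      + (\<alpha> t + lcm_exp \<alpha> (insert s S) - lcm_exp \<alpha> (insert t (insert s S)))"
    by (rule poly_mapping_eqI, simp only: lookup_add lookup_minus_expo lookup_lcm_exp_insert assms finite_insert)
       linarith
  then have "mono (\<alpha> t + lcm_exp \<alpha> S - lcm_exp \<alpha> (insert t S))
      * mono (\<alpha> s + lcm_exp \<alpha> (insert t S) - lcm_exp \<alpha> (insert s (insert t S)))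
    = mono (\<alpha> s + lcm_exp \<alpha> S - lcm_exp \<alpha> (insert s S))
      * (mono (\<alpha> t + lcm_exp \<alpha> (insert s S) - lcm_exp \<alpha> (insert t (insert s S))) :: 'a mpoly)"
    by (simp add: mono_mult)
  then have "(g t * h s) * (mono (\<alpha> t + lcm_exp \<alpha> S - lcm_exp \<alpha> (insert t S))
      * mono (\<alpha> s + lcm_exp \<alpha> (insert t S) - lcm_exp \<alpha> (insert s (insert t S))))
    = (g t * h s) * (mono (\<alpha> s + lcm_exp \<alpha> S - lcm_exp \<alpha> (insert s S))
      * mono (\<alpha> t + lcm_exp \<alpha> (insert s S) - lcm_exp \<alpha> (insert t (insert s S))))"
    by (simp only:)
  then show ?thesis unfolding homotopy_coef_def
    by (simp only: ac_simps)
qed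

lemma comp_sigma_e_self:
  assumes "S \<subseteq> {1..r}"
  shows "comp (Pow {1..r}) (sigma_e \<alpha> f r i) (sigma_e \<alpha> f r i) S T = 0"
  unfolding sigma_e_eq_raise
  by (rule comp_raise_self[OF assms homotopy_coef_swap[OF finite_subset[OF assms finite_atLeastAtMost]]])

lemma comp_sigma_e_anticommute:
  assumes "S \<subseteq> {1..r}"
  shows "comp (Pow {1..r}) (sigma_e \<alpha> f r i) (sigma_e \<alpha> f r j) S T
        + comp (Pow {1..r}) (sigma_e \<alpha> f r j) (sigma_e \<alpha> f r i) S T = 0"
  unfolding sigma_e_eq_raise
  by (rule comp_raise_anticommute[OF assms homotopy_coef_swap[OF finite_subset[OF assms finite_atLeastAtMost]]])

text \<open>Moving up and down along one index \<open>t\<close> contributes f_t m_t, through tau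
  sigma if \<open>t\<close> is outside \<open>S\<close> and through sigma tau if it is inside, so
  every index of \<open>{1..r}\<close> occurs once. Adding \<open>t\<close> and removing a different
  \<open>s\<close> occurs in both composites with opposite signs.\<close>

lemma comp_taylor_sigma:
  assumes S: "S \<subseteq> {1..r}"
  shows "comp (Pow {1..r}) (taylor_diff \<alpha> r) (sigma_e \<alpha> f r i) S T
       + comp (Pow {1..r}) (sigma_e \<alpha> f r i) (taylor_diff \<alpha> r) S T
       = (if T = S then \<Sum>j\<in>{1..r}. f i j * mono (\<alpha> j) else 0)"
proof -
  define g where "g = homotopy_coef \<alpha> (f i)"
  define q where "q = (taylor_coef \<alpha> :: _ \<Rightarrow> _ \<Rightarrow> 'a mpoly)"
  define A where "A = {1..r} - S"
  define m where "m j = (if T = S then f i j * mono (\<alpha> j) else 0)" for j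
  define K where "K t s = (if T = insert t (S - {s}) then
      sg S t * sg (insert t S) s * (g S t * q (insert t (S - {s})) s) else 0)" for t s
  have fin: "finite S" using S finite_subset by blast
  have diag: "g S' t * q S' t = f i t * mono (\<alpha> t)" if "finite S'" for S' t
  proof -
    have "\<alpha> t + lcm_exp \<alpha> S' - lcm_exp \<alpha> (insert t S') + (lcm_exp \<alpha> (insert t S') - lcm_exp \<alpha> S') = \<alpha> t"
      by (rule poly_mapping_eqI, simp only: lookup_add lookup_minus_expo lookup_lcm_exp_insert that finite_insert)
    then show ?thesis
      by (simp add: g_def q_def homotopy_coef_def taylor_coef_def mono_mult mult.assoc)
  qed
  \<comment> \<open>Either path around the square gives f_t times m_t m_S divided by the lcm over
    \<open>insert t (S - {s})\<close>.\<close>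
  have off: "g S t * q (insert t (S - {s})) s = q (S - {s}) s * g (S - {s}) t"
    if "s \<in> S" for s t
  proof -
    define S' where "S' = S - {s}"
    have S': "insert s S' = S" "finite S'" using that fin by (auto simp: S'_def)
    have "\<alpha> t + lcm_exp \<alpha> (insert s S') - lcm_exp \<alpha> (insert t (insert s S'))
        + (lcm_exp \<alpha> (insert s (insert t S')) - lcm_exp \<alpha> (insert t S'))
      = lcm_exp \<alpha> (insert s S') - lcm_exp \<alpha> S' + (\<alpha> t + lcm_exp \<alpha> S' - lcm_exp \<alpha> (insert t S'))"
      by (rule poly_mapping_eqI, simp only: lookup_add lookup_minus_expo lookup_lcm_exp_insert S'(2) finite_insert)
       linarith
    then have "f i t * (mono (\<alpha> t + lcm_exp \<alpha> (insert s S') - lcm_exp \<alpha> (insert t (insert s S')))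
        * mono (lcm_exp \<alpha> (insert s (insert t S')) - lcm_exp \<alpha> (insert t S')))
      = f i t * (mono (lcm_exp \<alpha> (insert s S') - lcm_exp \<alpha> S')
        * mono (\<alpha> t + lcm_exp \<alpha> S' - lcm_exp \<alpha> (insert t S')))"
      by (simp only: mono_mult)
    then show ?thesis unfolding g_def q_def homotopy_coef_def taylor_coef_def S'_def[symmetric]
      by (simp only: ac_simps S'(1))
  qed
  have "comp (Pow {1..r}) (taylor_diff \<alpha> r) (sigma_e \<alpha> f r i) S T
      = (\<Sum>t\<in>A. sg S t * g S t * taylor_diff \<alpha> r (insert t S) T)"
    unfolding comp_def sigma_e_eq_raise A_def g_def by (rule sum_raise[OF S])
  also have "\<dots> = (\<Sum>t\<in>A. m t + (\<Sum>s\<in>S. K t s))"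
  proof (rule sum.cong)
    fix t assume t: "t \<in> A"
    then have tS: "t \<notin> S" "insert t S \<subseteq> {1..r}" using S by (auto simp: A_def)
    have "sg S t * g S t * taylor_diff \<alpha> r (insert t S) T
      = sg S t * g S t * (if T = S then sg S t * q S t else 0)
       + (\<Sum>s\<in>S. sg S t * g S t * (if T = insert t S - {s} then sg (insert t S) s * q (insert t S - {s}) s else 0))"
      unfolding taylor_diff_eq_sum[OF tS(2)] q_def[symmetric] using fin tS
      by (simp add: sum_distrib_left distrib_left)
    also have "sg S t * g S t * (if T = S then sg S t * q S t else 0) = m t"
    proof -
      have "sg S t * g S t * (sg S t * q S t) = (sg S t * sg S t) * (g S t * q S t)"
        by (simp add: ac_simps del: sg_sq)
      then show ?thesis by (simp add: m_def diag[OF fin])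
    qed
    also have "(\<Sum>s\<in>S. sg S t * g S t * (if T = insert t S - {s} then sg (insert t S) s * q (insert t S - {s}) s else 0))
      = (\<Sum>s\<in>S. K t s)"
    proof (rule sum.cong)
      fix s assume "s \<in> S"
      then have "insert t S - {s} = insert t (S - {s})" using tS by auto
      then show "sg S t * g S t * (if T = insert t S - {s} then sg (insert t S) s * q (insert t S - {s}) s else 0) = K t s"
        by (simp add: K_def ac_simps)
    qed simp
    finally show "sg S t * g S t * taylor_diff \<alpha> r (insert t S) T = m t + (\<Sum>s\<in>S. K t s)" .
  qed simp
  finally have 1: "comp (Pow {1..r}) (taylor_diff \<alpha> r) (sigma_e \<alpha> f r i) S T
      = (\<Sum>t\<in>A. m t) + (\<Sum>t\<in>A. \<Sum>s\<in>S. K t s)"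
    by (simp add: sum.distrib)
  have "comp (Pow {1..r}) (sigma_e \<alpha> f r i) (taylor_diff \<alpha> r) S T
      = (\<Sum>s\<in>S. sg S s * q (S - {s}) s * raise r g (S - {s}) T)"
  proof -
    have "comp (Pow {1..r}) (sigma_e \<alpha> f r i) (taylor_diff \<alpha> r) S T
      = (\<Sum>S'\<in>Pow {1..r}. \<Sum>s\<in>S. if S' = S - {s} then sg S s * q (S - {s}) s * raise r g S' T else 0)"
      unfolding comp_def taylor_diff_eq_sum[OF S] sigma_e_eq_raise g_def q_def
      by (simp add: sum_distrib_right if_distrib[of "\<lambda>x. x * _"] cong: if_cong)
    also have "\<dots> = (\<Sum>s\<in>S. \<Sum>S'\<in>Pow {1..r}. if S' = S - {s} then sg S s * q (S - {s}) s * raise r g S' T else 0)"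
      by (rule sum.swap)
    also have "\<dots> = (\<Sum>s\<in>S. sg S s * q (S - {s}) s * raise r g (S - {s}) T)"
      by (rule sum.cong) (use S in \<open>auto simp: sum.delta\<close>)
    finally show ?thesis .
  qed
  also have "\<dots> = (\<Sum>s\<in>S. m s + (\<Sum>t\<in>A. - K t s))"
  proof (rule sum.cong)
    fix s assume s: "s \<in> S"
    have eq: "{1..r} - (S - {s}) = insert s A" "s \<notin> A" "S - {s} \<subseteq> {1..r}" "finite A"
      using s S by (auto simp: A_def)
    have "sg S s * q (S - {s}) s * raise r g (S - {s}) T
      = sg S s * q (S - {s}) s * (if T = S then sg S s * g (S - {s}) s else 0)
       + (\<Sum>t\<in>A. sg S s * q (S - {s}) s * (if T = insert t (S - {s}) then sg (S - {s}) t * g (S - {s}) t else 0))"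
      unfolding raise_def eq using eq s
      by (simp add: sum_distrib_left distrib_left insert_absorb)
    also have "sg S s * q (S - {s}) s * (if T = S then sg S s * g (S - {s}) s else 0) = m s"
    proof -
      have "sg S s * q (S - {s}) s * (sg S s * g (S - {s}) s)
          = (sg S s * sg S s) * (g (S - {s}) s * q (S - {s}) s)"
        by (simp add: ac_simps del: sg_sq)
      then show ?thesis using fin by (simp add: m_def diag)
    qed
    also have "(\<Sum>t\<in>A. sg S s * q (S - {s}) s * (if T = insert t (S - {s}) then sg (S - {s}) t * g (S - {s}) t else 0))
      = (\<Sum>t\<in>A. - K t s)"
    proof (rule sum.cong)
      fix t assume "t \<in> A"
      then have "t \<notin> S" by (simp add: A_def)
      have "sg S s * q (S - {s}) s * (sg (S - {s}) t * g (S - {s}) t)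
          = (sg S s * sg (S - {s}) t) * (q (S - {s}) s * g (S - {s}) t)"
        by (simp add: ac_simps)
      also have "\<dots> = - (sg S t * sg (insert t S) s) * (g S t * q (insert t (S - {s})) s)"
        using sg_swap_remove[OF fin s \<open>t \<notin> S\<close>, where ?'a = "'a mpoly"] off[OF s, of t] by simp
      finally show "sg S s * q (S - {s}) s * (if T = insert t (S - {s}) then sg (S - {s}) t * g (S - {s}) t else 0) = - K t s"
        by (simp add: K_def)
    qed simp
    finally show "sg S s * q (S - {s}) s * raise r g (S - {s}) T = m s + (\<Sum>t\<in>A. - K t s)" .
  qed simp
  finally have 2: "comp (Pow {1..r}) (sigma_e \<alpha> f r i) (taylor_diff \<alpha> r) S T
      = (\<Sum>s\<in>S. m s) - (\<Sum>t\<in>A. \<Sum>s\<in>S. K t s)"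
    by (simp add: sum_negf sum_subtractf sum.swap[of _ S A])
  have "(\<Sum>t\<in>A. m t) + (\<Sum>s\<in>S. m s) = (\<Sum>j\<in>{1..r}. m j)"
    unfolding A_def using sum.subset_diff[OF S, of m] by simp
  moreover have "(\<Sum>j\<in>{1..r}. m j) = (if T = S then \<Sum>j\<in>{1..r}. f i j * mono (\<alpha> j) else 0)"
    by (simp add: m_def)
  ultimately show ?thesis unfolding 1 2 by simp
qed

subsection \<open>Acyclicity of the Taylor complex\<close>

lemma lookup_sg_mult:
  fixes p :: "'k::field mpoly"
  shows "Poly_Mapping.lookup (sg S t * p) b = sg S t * Poly_Mapping.lookup p b"
proof -
  have "sg S t = (1 :: 'k mpoly) \<and> sg S t = (1::'k) \<or> sg S t = (-1 :: 'k mpoly) \<and> sg S t = (-1::'k)"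
    by (cases "even (card {u\<in>S. t < u})") (simp_all add: sg_def)
  then show ?thesis by auto
qed

lemma sum_taylor_diff:
  assumes "T \<subseteq> {1..r}"
  shows "(\<Sum>S\<in>Pow {1..r}. x S * taylor_diff \<alpha> r S T)
    = (\<Sum>t\<in>{1..r} - T. sg T t * (x (insert t T) * mono (lcm_exp \<alpha> (insert t T) - lcm_exp \<alpha> T)))"
  using sum_raise[OF assms, of "taylor_coef \<alpha>" x]
  by (simp add: taylor_diff_eq_raise taylor_coef_def ac_simps)

lemma taylor_diff_outside: "\<not> T \<subseteq> {1..r} \<Longrightarrow> taylor_diff \<alpha> r S T = 0"
  by (simp add: taylor_diff_eq_raise raise_def)

text \<open>The \<open>S\<close>-entry of the part of \<^term>\<open>x\<close> of multidegree \<^term>\<open>e\<close>.\<close>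
definition component :: "(nat \<Rightarrow> expo) \<Rightarrow> (nat set \<Rightarrow> 'k::field mpoly) \<Rightarrow> nat set \<Rightarrow> expo \<Rightarrow> 'k" where
  "component \<alpha> x S e =
    (if expo_le (lcm_exp \<alpha> S) e then Poly_Mapping.lookup (x S) (e - lcm_exp \<alpha> S) else 0)"

text \<open>Each entry of the differential is a sign times the monomial that preserves multidegree,
  so in a fixed multidegree only a simplicial boundary over the field remains. The default value 0
  of \<open>component\<close> accounts for the sets whose lcm does not divide
  \<open>e\<close>.\<close>

lemma component_sum_taylor_diff:
  assumes T: "T \<subseteq> {1..r}" and le: "expo_le (lcm_exp \<alpha> T) e"
  shows "Poly_Mapping.lookup (\<Sum>S\<in>Pow {1..r}. x S * taylor_diff \<alpha> r S T) (e - lcm_exp \<alpha> T)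
    = (\<Sum>t\<in>{1..r} - T. sg T t * component \<alpha> x (insert t T) e)"
  unfolding sum_taylor_diff[OF T] lookup_sum lookup_sg_mult
proof (rule sum.cong)
  fix t
  have fin: "finite T" using T finite_subset by blast
  have TtoU: "expo_le (lcm_exp \<alpha> T) (lcm_exp \<alpha> (insert t T))" by (rule expo_le_lcm_exp_insert[OF fin])
  have "expo_le (lcm_exp \<alpha> (insert t T) - lcm_exp \<alpha> T) (e - lcm_exp \<alpha> T)
      \<longleftrightarrow> expo_le (lcm_exp \<alpha> (insert t T)) e"
    using le TtoU unfolding expo_le_def lookup_minus_expo by (meson diff_le_mono eq_diff_iff le_diff_iff)
  moreover have "e - lcm_exp \<alpha> T - (lcm_exp \<alpha> (insert t T) - lcm_exp \<alpha> T) = e - lcm_exp \<alpha> (insert t T)"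
    by (rule poly_mapping_eqI) (use TtoU in \<open>simp add: expo_le_def lookup_minus_expo\<close>)
  ultimately show "sg T t * Poly_Mapping.lookup (x (insert t T) * mono (lcm_exp \<alpha> (insert t T) - lcm_exp \<alpha> T))
      (e - lcm_exp \<alpha> T) = sg T t * component \<alpha> x (insert t T) e"
    by (simp add: lookup_mult_mono component_def)
qed simp

text \<open>In multidegree \<open>e\<close> the Taylor complex is the augmented chain complex of the
  full simplex on the indices whose generator divides \<open>e\<close>. The top divisor serves as
  apex of a cone. It varies with \<open>e\<close>, so the contraction is linear over the field only
  and must be defined monomial by monomial.\<close>

definition top_divisor :: "(nat \<Rightarrow> expo) \<Rightarrow> nat \<Rightarrow> expo \<Rightarrow> nat \<Rightarrow> bool" where
  "top_divisor \<alpha> r e j \<longleftrightarrow> j \<in> {1..r} \<and> expo_le (\<alpha> j) e \<and> (\<forall>i\<in>{1..r}. expo_le (\<alpha> i) e \<longrightarrow> i \<le> j)"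

lemma top_divisor_exists:
  assumes "i \<in> {1..r}" "expo_le (\<alpha> i) e"
  obtains j where "top_divisor \<alpha> r e j"
proof -
  let ?J = "{i\<in>{1..r}. expo_le (\<alpha> i) e}"
  have "finite ?J" "?J \<noteq> {}" using assms by auto
  then have "Max ?J \<in> ?J" by (rule Max_in)
  moreover have "\<forall>i\<in>?J. i \<le> Max ?J" using \<open>finite ?J\<close> by simp
  ultimately have "top_divisor \<alpha> r e (Max ?J)" unfolding top_divisor_def by blast
  then show ?thesis by (rule that)
qed

lemma top_divisor_unique: "top_divisor \<alpha> r e i \<Longrightarrow> top_divisor \<alpha> r e j \<Longrightarrow> i = j"
  unfolding top_divisor_def by (meson le_antisym)

text \<open>The contraction sends a multihomogeneous element \<open>m \<epsilon>\<^sub>S\<close> of multidegree \<open>e\<close> to the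
  multiple of \<open>\<epsilon>\<^bsub>S \<union> {j}\<^esub>\<close> of the same multidegree, where \<open>j\<close> is the largest index with \<open>m\<^sub>j\<close>
  dividing the monomial with exponent \<open>e\<close>. As \<open>j\<close> is maximal in \<open>S \<union> {j}\<close>, it occurs with sign \<open>+1\<close>.\<close>
definition contraction :: "(nat \<Rightarrow> expo) \<Rightarrow> nat \<Rightarrow> (nat set \<Rightarrow> 'k::field mpoly) \<Rightarrow> nat set \<Rightarrow> 'k mpoly" where
  "contraction \<alpha> r x U = (\<Sum>j\<in>U.
     \<Sum>b\<in>{b\<in>Poly_Mapping.keys (x (U - {j})). top_divisor \<alpha> r (b + lcm_exp \<alpha> (U - {j})) j}.
       Poly_Mapping.single (b + lcm_exp \<alpha> (U - {j}) - lcm_exp \<alpha> U) (Poly_Mapping.lookup (x (U - {j})) b))"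

lemma component_contraction:
  assumes "finite U"
  shows "component \<alpha> (contraction \<alpha> r x) U e
    = (\<Sum>j\<in>U. if top_divisor \<alpha> r e j then component \<alpha> x (U - {j}) e else 0)"
proof (cases "expo_le (lcm_exp \<alpha> U) e")
  case False
  \<comment> \<open>If the generators of the apex \<open>j\<close> and of all other indices of
    \<open>U\<close> divided \<open>e\<close>, so would the lcm of \<open>U\<close>.\<close>
  have "component \<alpha> x (U - {j}) e = 0" if "j \<in> U" "top_divisor \<alpha> r e j" for j
  proof -
    have "\<not> expo_le (lcm_exp \<alpha> (U - {j})) e"
      using False that assms by (auto simp: expo_le_lcm_exp_iff top_divisor_def)
    then show ?thesis by (simp add: component_def)
  qed
  with False show ?thesis by (simp add: component_def sum.neutral)
next
  case True
  have "(\<Sum>b\<in>{b\<in>Poly_Mapping.keys (x (U - {j})). top_divisor \<alpha> r (b + lcm_exp \<alpha> (U - {j})) j}.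
       Poly_Mapping.lookup (Poly_Mapping.single (b + lcm_exp \<alpha> (U - {j}) - lcm_exp \<alpha> U)
         (Poly_Mapping.lookup (x (U - {j})) b)) (e - lcm_exp \<alpha> U))
     = (if top_divisor \<alpha> r e j then component \<alpha> x (U - {j}) e else 0)" (is "?L = ?R")
    if j: "j \<in> U" for j
  proof -
    define l where "l = lcm_exp \<alpha> (U - {j})"
    have U: "insert j (U - {j}) = U" using j by auto
    have l: "expo_le l (lcm_exp \<alpha> U)"
      using expo_le_lcm_exp_insert[of "U - {j}" \<alpha> j] assms unfolding U l_def by simp
    then have le: "expo_le l e" using True expo_le_trans by blast
    \<comment> \<open>Subtracting \<open>lcm_exp \<alpha> U\<close> is injective here because it
      divides both \<open>e\<close> and \<open>b + l\<close>; the latter holds since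
      \<open>j\<close> is the top divisor of \<open>b + l\<close>.\<close>
    have eq: "b + l - lcm_exp \<alpha> U = e - lcm_exp \<alpha> U \<longleftrightarrow> b = e - l"
      if top: "top_divisor \<alpha> r (b + l) j" for b
    proof -
      have "expo_le (lcm_exp \<alpha> (U - {j})) (b + l)"
        using expo_le_add[of l b] by (simp add: l_def add.commute)
      then have "expo_le (lcm_exp \<alpha> U) (b + l)"
        using top assms by (auto simp: expo_le_lcm_exp_iff top_divisor_def)
      then have "b + l - lcm_exp \<alpha> U = e - lcm_exp \<alpha> U \<longleftrightarrow> b + l = e"
        using expo_le_add_diff True by metis
      also have "\<dots> \<longleftrightarrow> b = e - l"
        using expo_le_add_diff[OF le] by (metis add.commute add_diff_cancel_right')
      finally show ?thesis .
    qed
    have "?L = (\<Sum>b\<in>{b\<in>Poly_Mapping.keys (x (U - {j})). top_divisor \<alpha> r (b + l) j}.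
        if b = e - l then Poly_Mapping.lookup (x (U - {j})) b else 0)"
      unfolding l_def[symmetric]
    proof (rule sum.cong)
      fix b assume "b \<in> {b\<in>Poly_Mapping.keys (x (U - {j})). top_divisor \<alpha> r (b + l) j}"
      then show "Poly_Mapping.lookup (Poly_Mapping.single (b + l - lcm_exp \<alpha> U)
         (Poly_Mapping.lookup (x (U - {j})) b)) (e - lcm_exp \<alpha> U)
        = (if b = e - l then Poly_Mapping.lookup (x (U - {j})) b else 0)"
        using eq[of b] by (simp add: lookup_single when_def)
    qed simp
    also have "\<dots> = (if e - l \<in> Poly_Mapping.keys (x (U - {j})) \<and> top_divisor \<alpha> r (e - l + l) j
        then Poly_Mapping.lookup (x (U - {j})) (e - l) else 0)"
      by simp
    also have "e - l + l = e" using expo_le_add_diff[OF le] by (simp add: add.commute)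
    also have "(if e - l \<in> Poly_Mapping.keys (x (U - {j})) \<and> top_divisor \<alpha> r e j
        then Poly_Mapping.lookup (x (U - {j})) (e - l) else 0) = ?R"
      using le by (simp add: component_def l_def in_keys_iff)
    finally show ?thesis .
  qed
  then show ?thesis
    using True by (simp add: component_def contraction_def lookup_sum)
qed

lemma contraction_in_Qn:
  assumes mon: "\<forall>j\<in>{1..r}. Poly_Mapping.keys (\<alpha> j) \<subseteq> {..<n}"
    and x: "\<And>S. x S \<in> Qn n" and U: "U \<subseteq> {1..r}"
  shows "contraction \<alpha> r x U \<in> Qn n"
  unfolding contraction_def
proof (intro Qn_sum)
  fix j b
  assume b: "b \<in> {b\<in>Poly_Mapping.keys (x (U - {j})). top_divisor \<alpha> r (b + lcm_exp \<alpha> (U - {j})) j}"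
  have "finite U" using U finite_subset by blast
  then have "Poly_Mapping.keys (lcm_exp \<alpha> (U - {j})) \<subseteq> {..<n}"
    by (rule keys_lcm_exp[OF finite_Diff]) (use mon U in blast)
  moreover have "Poly_Mapping.keys b \<subseteq> {..<n}"
    using b x[of "U - {j}"] by (simp add: Qn_def)
  moreover have "Poly_Mapping.keys (b + lcm_exp \<alpha> (U - {j}) - lcm_exp \<alpha> U)
      \<subseteq> Poly_Mapping.keys b \<union> Poly_Mapping.keys (lcm_exp \<alpha> (U - {j}))"
    by (auto simp: in_keys_iff lookup_add lookup_minus_expo)
  ultimately have "Poly_Mapping.keys (b + lcm_exp \<alpha> (U - {j}) - lcm_exp \<alpha> U) \<subseteq> {..<n}" by blast
  then show "Poly_Mapping.single (b + lcm_exp \<alpha> (U - {j}) - lcm_exp \<alpha> U)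
      (Poly_Mapping.lookup (x (U - {j})) b) \<in> Qn n"
    by (simp add: Qn_def)
qed

lemma contraction_eq_0: "(\<And>j. j \<in> U \<Longrightarrow> x (U - {j}) = 0) \<Longrightarrow> contraction \<alpha> r x U = 0"
  by (simp add: contraction_def)

text \<open>If the apex is not in \<open>T\<close>, only its insertion contributes, and it returns
  the entry of \<open>x\<close> at \<open>T\<close>. If the apex is in \<open>T\<close>, the sum is
  what the cycle condition at \<open>T\<close> without the apex yields when solved for that
  entry.\<close>

lemma taylor_diff_contraction:
  assumes cycle: "\<And>T. (\<Sum>S\<in>Pow {1..r}. x S * taylor_diff \<alpha> r S T) = 0"
    and T: "T \<subseteq> {1..r}" "T \<noteq> {}"
  shows "(\<Sum>S\<in>Pow {1..r}. contraction \<alpha> r x S * taylor_diff \<alpha> r S T) = x T"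
proof (rule poly_mapping_eqI)
  fix b
  define e where "e = b + lcm_exp \<alpha> T"
  have fin: "finite T" using T finite_subset by blast
  have le: "expo_le (lcm_exp \<alpha> T) e"
    using expo_le_add[of "lcm_exp \<alpha> T" b] by (simp add: e_def add.commute)
  have b: "e - lcm_exp \<alpha> T = b" by (simp add: e_def)
  have div: "expo_le (\<alpha> i) e" if "i \<in> T" for i
    using le that fin by (simp add: expo_le_lcm_exp_iff)
  \<comment> \<open>A nonempty \<open>T\<close> provides a generator dividing \<open>e\<close>,
    hence an apex; for the empty set there may be none.\<close>
  from T obtain i where "i \<in> T" "i \<in> {1..r}" by blast
  with div obtain j where j: "top_divisor \<alpha> r e j" using top_divisor_exists by metis
  then have jr: "j \<in> {1..r}" by (simp add: top_divisor_def)
  have max: "i \<le> j" if "i \<in> {1..r}" "expo_le (\<alpha> i) e" for i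
    using j that by (simp add: top_divisor_def)
  have sgj: "sg T j = (1::'a)"
  proof -
    have "{u\<in>T. j < u} = {}" using max div T by fastforce
    then show ?thesis unfolding sg_def by (metis card.empty power_0)
  qed
  have X: "component \<alpha> (contraction \<alpha> r x) U e = (if j \<in> U then component \<alpha> x (U - {j}) e else 0)"
    if "finite U" for U
  proof -
    have "top_divisor \<alpha> r e i \<longleftrightarrow> i = j" for i
      using top_divisor_unique[OF j] j by blast
    then show ?thesis using that by (simp add: component_contraction)
  qed
  have "Poly_Mapping.lookup (\<Sum>S\<in>Pow {1..r}. contraction \<alpha> r x S * taylor_diff \<alpha> r S T) b
      = (\<Sum>t\<in>{1..r} - T. sg T t * component \<alpha> (contraction \<alpha> r x) (insert t T) e)"
    using component_sum_taylor_diff[OF T(1) le] by (simp add: b)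
  also have "\<dots> = (\<Sum>t\<in>{1..r} - T. sg T t * (if j \<in> insert t T then component \<alpha> x (insert t T - {j}) e else 0))"
    by (simp add: X fin)
  also have "\<dots> = component \<alpha> x T e"
  proof (cases "j \<in> T")
    case False
    have "(\<Sum>t\<in>{1..r} - T. sg T t * (if j \<in> insert t T then component \<alpha> x (insert t T - {j}) e else 0))
        = (\<Sum>t\<in>{1..r} - T. if t = j then sg T t * component \<alpha> x (insert t T - {j}) e else 0)"
      using False by (intro sum.cong) auto
    also have "\<dots> = component \<alpha> x T e" using False jr sgj by simp
    finally show ?thesis .
  next
    case True
    define T' where "T' = T - {j}"
    have T': "T' \<subseteq> {1..r}" "finite T'" "insert j T' = T" "j \<notin> T'" "{1..r} - T' = insert j ({1..r} - T)"
      using T True fin by (auto simp: T'_def)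
    have le': "expo_le (lcm_exp \<alpha> T') e"
      using le fin T' div by (simp add: expo_le_lcm_exp_iff T'_def)
    have "0 = (\<Sum>t\<in>{1..r} - T'. sg T' t * component \<alpha> x (insert t T') e)"
      using component_sum_taylor_diff[OF T'(1) le', of x] unfolding cycle lookup_zero .
    also have "\<dots> = sg T' j * component \<alpha> x T e + (\<Sum>t\<in>{1..r} - T. sg T' t * component \<alpha> x (insert t T') e)"
      unfolding T'(5) using T' True by simp
    also have "sg T' j = (1::'a)" using sgj by (simp add: T'_def)
    also have "(\<Sum>t\<in>{1..r} - T. sg T' t * component \<alpha> x (insert t T') e)
      = - (\<Sum>t\<in>{1..r} - T. sg T t * component \<alpha> x (insert t T') e)"
      unfolding sum_negf[symmetric]
    proof (rule sum.cong)
      fix t assume t: "t \<in> {1..r} - T"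
      show "sg T' t * component \<alpha> x (insert t T') e = - (sg T t * component \<alpha> x (insert t T') e)"
      \<comment> \<open>An index whose generator divides \<open>e\<close> lies below the apex, so
        deleting the apex flips its sign; for any other index the component is 0.\<close>
      proof (cases "expo_le (\<alpha> t) e")
        case True
        with max t have "t \<le> j" by blast
        moreover have "t \<noteq> j" using t \<open>j \<in> T\<close> by blast
        ultimately have "sg T t = (- sg T' t :: 'a)"
          using sg_insert[of T' j t, where ?'a = 'a] T' by simp
        then show ?thesis by simp
      next
        case False
        then have "component \<alpha> x (insert t T') e = 0"
          using T' by (simp add: component_def expo_le_lcm_exp_iff)
        then show ?thesis by simp
      qed
    qed simp
    finally have "component \<alpha> x T e = (\<Sum>t\<in>{1..r} - T. sg T t * component \<alpha> x (insert t T') e)" by simp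
    moreover have "insert t T - {j} = insert t T'" if "t \<in> {1..r} - T" for t
      using that True by (auto simp: T'_def)
    ultimately show ?thesis using True by simp
  qed
  also have "\<dots> = Poly_Mapping.lookup (x T) b"
    using le by (simp add: component_def b)
  finally show "Poly_Mapping.lookup (\<Sum>S\<in>Pow {1..r}. contraction \<alpha> r x S * taylor_diff \<alpha> r S T) b
      = Poly_Mapping.lookup (x T) b" .
qed

lemma taylor_acyclic:
  assumes mon: "\<forall>j\<in>{1..r}. Poly_Mapping.keys (\<alpha> j) \<subseteq> {..<n}" and d: "1 \<le> d"
    and xQ: "\<And>S. x S \<in> Qn n"
    and supp: "\<And>S. x S \<noteq> 0 \<Longrightarrow> S \<subseteq> {1..r} \<and> card S = d"
    and cycle: "\<And>T. (\<Sum>S\<in>Pow {1..r}. x S * taylor_diff \<alpha> r S T) = 0"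
  obtains y where "\<And>S. y S \<in> Qn n" "\<And>S. y S \<noteq> 0 \<Longrightarrow> S \<subseteq> {1..r} \<and> card S = Suc d"
    "\<And>T. (\<Sum>S\<in>Pow {1..r}. y S * taylor_diff \<alpha> r S T) = x T"
proof
  define y where "y S = (if S \<subseteq> {1..r} then contraction \<alpha> r x S else 0)" for S
  show "y S \<in> Qn n" for S
    using contraction_in_Qn[OF mon xQ] by (simp add: y_def)
  have card: "card S = Suc d" if "contraction \<alpha> r x S \<noteq> 0" "S \<subseteq> {1..r}" for S
  proof -
    have "\<exists>j\<in>S. x (S - {j}) \<noteq> 0" using that(1) contraction_eq_0 by metis
    then obtain j where "j \<in> S" "card (S - {j}) = d" using supp by blast
    moreover have "finite S" using that(2) finite_subset by blast
    ultimately show ?thesis using d by (simp add: card_Diff_singleton_if)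
  qed
  then show "S \<subseteq> {1..r} \<and> card S = Suc d" if "y S \<noteq> 0" for S
    using that by (auto simp: y_def split: if_splits)
  show "(\<Sum>S\<in>Pow {1..r}. y S * taylor_diff \<alpha> r S T) = x T" for T
  proof -
    have "(\<Sum>S\<in>Pow {1..r}. y S * taylor_diff \<alpha> r S T)
        = (\<Sum>S\<in>Pow {1..r}. contraction \<alpha> r x S * taylor_diff \<alpha> r S T)"
      by (rule sum.cong) (simp_all add: y_def)
    also have "\<dots> = x T"
    proof (cases "T \<subseteq> {1..r} \<and> T \<noteq> {}")
      case True
      then show ?thesis using taylor_diff_contraction[OF cycle] by blast
    next
      case False
      \<comment> \<open>Here \<open>T\<close> is empty or leaves \<open>{1..r}\<close>. The entry
        \<open>x T\<close> vanishes as \<open>d\<close> is positive, and an empty face would force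
        \<open>card S = 1\<close> instead of \<open>Suc d\<close>.\<close>
      have "x T = 0" by (rule ccontr) (use False supp[of T] d in auto)
      moreover have "contraction \<alpha> r x S * taylor_diff \<alpha> r S T = 0" if "S \<in> Pow {1..r}" for S
      proof (rule ccontr)
        assume *: "contraction \<alpha> r x S * taylor_diff \<alpha> r S T \<noteq> 0"
        then have "taylor_diff \<alpha> r S T \<noteq> (0 :: 'a mpoly)" "contraction \<alpha> r x S \<noteq> 0" by auto
        then have "card S = Suc d" "raise r (taylor_coef \<alpha>) T S \<noteq> (0 :: 'a mpoly)"
          using card that by (auto simp: taylor_diff_eq_raise)
        from this(2) obtain t where "T \<subseteq> {1..r}" "S = insert t T" by (rule raise_nonzeroD)
        with False \<open>card S = Suc d\<close> d show False by simp
      qed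
      ultimately show ?thesis by (simp add: sum.neutral)
    qed
    finally show ?thesis .
  qed
qed

subsection \<open>Membership in ideals\<close>

lemma gen_ideal_0 [simp]: "0 \<in> gen_ideal n J g"
  unfolding gen_ideal_def by (intro CollectI exI[of _ "\<lambda>_. 0"]) simp

lemma gen_ideal_add:
  assumes "x \<in> gen_ideal n J g" "y \<in> gen_ideal n J g"
  shows "x + y \<in> gen_ideal n J g"
proof -
  from assms obtain h h' where "\<forall>j\<in>J. h j \<in> Qn n" "x = (\<Sum>j\<in>J. h j * g j)"
    "\<forall>j\<in>J. h' j \<in> Qn n" "y = (\<Sum>j\<in>J. h' j * g j)" unfolding gen_ideal_def by blast
  then show ?thesis unfolding gen_ideal_def
    by (intro CollectI exI[of _ "\<lambda>j. h j + h' j"]) (auto simp: distrib_right sum.distrib)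
qed

lemma gen_ideal_mult:
  assumes "p \<in> Qn n" "x \<in> gen_ideal n J g"
  shows "p * x \<in> gen_ideal n J g"
proof -
  from assms obtain h where "\<forall>j\<in>J. h j \<in> Qn n" "x = (\<Sum>j\<in>J. h j * g j)"
    unfolding gen_ideal_def by blast
  with assms(1) show ?thesis unfolding gen_ideal_def
    by (intro CollectI exI[of _ "\<lambda>j. p * h j"]) (auto simp: sum_distrib_left mult.assoc)
qed

lemma gen_ideal_uminus: "x \<in> gen_ideal n J g \<Longrightarrow> - x \<in> gen_ideal n J g"
  using gen_ideal_mult[of "-1" n x] by auto

lemma gen_ideal_diff:
  "x \<in> gen_ideal n J g \<Longrightarrow> y \<in> gen_ideal n J g \<Longrightarrow> x - y \<in> gen_ideal n J g"
  using gen_ideal_add[OF _ gen_ideal_uminus, of x n J g y] by simp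

lemma gen_ideal_sum: "(\<And>i. i \<in> A \<Longrightarrow> p i \<in> gen_ideal n J g) \<Longrightarrow> sum p A \<in> gen_ideal n J g"
  by (induction A rule: infinite_finite_induct) (auto intro: gen_ideal_add)

lemma gen_ideal_empty [simp]: "gen_ideal n {} g = {0}"
  by (auto simp: gen_ideal_def)

text \<open>Splitting off one generator turns membership into a congruence modulo the smaller ideal
  with an explicit quotient \<open>z\<close>. This is the division from which the inductive step for
  exactness starts.\<close>

lemma gen_ideal_insert:
  assumes "finite J" "j \<notin> J"
  shows "x \<in> gen_ideal n (insert j J) g \<longleftrightarrow> (\<exists>z\<in>Qn n. x - g j * z \<in> gen_ideal n J g)"
proof
  assume "x \<in> gen_ideal n (insert j J) g"
  then obtain h where h: "\<forall>i\<in>insert j J. h i \<in> Qn n" "x = (\<Sum>i\<in>insert j J. h i * g i)"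
    unfolding gen_ideal_def by blast
  then have "x - g j * h j = (\<Sum>i\<in>J. h i * g i)" using assms by (simp add: mult.commute)
  then show "\<exists>z\<in>Qn n. x - g j * z \<in> gen_ideal n J g"
    using h(1) unfolding gen_ideal_def by (intro bexI[of _ "h j"]) auto
next
  assume "\<exists>z\<in>Qn n. x - g j * z \<in> gen_ideal n J g"
  then obtain z h where z: "z \<in> Qn n" and h: "\<forall>i\<in>J. h i \<in> Qn n" "x - g j * z = (\<Sum>i\<in>J. h i * g i)"
    unfolding gen_ideal_def by blast
  have "(\<Sum>i\<in>J. (h(j := z)) i * g i) = (\<Sum>i\<in>J. h i * g i)"
    by (rule sum.cong) (use assms in auto)
  then have "x = (\<Sum>i\<in>insert j J. (h(j := z)) i * g i)"
    using assms h(2) by (simp add: algebra_simps)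
  moreover have "\<forall>i\<in>insert j J. (h(j := z)) i \<in> Qn n" using z h(1) by simp
  ultimately show "x \<in> gen_ideal n (insert j J) g" unfolding gen_ideal_def by blast
qed

lemma gen_ideal_subset:
  assumes "J \<subseteq> K" "finite K"
  shows "gen_ideal n J g \<subseteq> gen_ideal n K g"
proof
  fix x assume "x \<in> gen_ideal n J g"
  then obtain h where h: "\<forall>j\<in>J. h j \<in> Qn n" "x = (\<Sum>j\<in>J. h j * g j)"
    unfolding gen_ideal_def by blast
  have "(\<Sum>j\<in>K. (if j \<in> J then h j else 0) * g j) = (\<Sum>j\<in>J. h j * g j)"
    using assms by (intro sum.mono_neutral_cong_right) auto
  then show "x \<in> gen_ideal n K g" using h unfolding gen_ideal_def
    by (intro CollectI exI[of _ "\<lambda>j. if j \<in> J then h j else 0"]) auto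
qed

lemma gen_ideal_generator:
  assumes "j \<in> J" "finite J"
  shows "g j \<in> gen_ideal n J g"
proof -
  have "\<exists>z\<in>Qn n. g j - g j * z \<in> gen_ideal n (J - {j}) g" by (rule bexI[of _ 1]) simp_all
  then have "g j \<in> gen_ideal n (insert j (J - {j})) g"
    using assms(2) gen_ideal_insert[of "J - {j}" j "g j" n g] by blast
  then show ?thesis using assms(1) by (simp add: insert_absorb)
qed

lemma gen_ideal_Suc:
  "x \<in> gen_ideal n {1..Suc c} g \<longleftrightarrow> (\<exists>z\<in>Qn n. x - g (Suc c) * z \<in> gen_ideal n {1..c} g)"
  by (subst gen_ideal_insert[symmetric]) (auto simp: atLeastAtMostSuc_conv)

lemma gen_ideal_Qn:
  assumes "\<forall>j\<in>J. g j \<in> Qn n" "x \<in> gen_ideal n J g"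
  shows "x \<in> Qn n"
  using assms unfolding gen_ideal_def by auto

subsection \<open>Operators on the Eisenbud--Shamash module\<close>

type_synonym 'k chain = "(nat \<Rightarrow> nat) \<times> nat set \<Rightarrow> 'k mpoly"

definition lift :: "nat \<Rightarrow> (nat set \<Rightarrow> nat set \<Rightarrow> 'k::field mpoly) \<Rightarrow> 'k chain \<Rightarrow> 'k chain" where
  "lift r M x B = (\<Sum>S\<in>Pow {1..r}. x (fst B, S) * M S (snd B))"

text \<open>This is t_i read on coefficients: t_i sends y^(u + e_i) to y^(u), so the value at u is
  the old coefficient at u + e_i.\<close>

definition shift :: "nat \<Rightarrow> 'k::field chain \<Rightarrow> 'k chain" where
  "shift i x B = x ((fst B)(i := Suc (fst B i)), snd B)"

text \<open>The recursion is on the number of homotopies in use, not on the number of exponent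
  variables of a chain, so that the exactness proof can switch them on one at a time.\<close>

primrec es_op :: "nat \<Rightarrow> (nat set \<Rightarrow> nat set \<Rightarrow> 'k::field mpoly)
    \<Rightarrow> (nat \<Rightarrow> nat set \<Rightarrow> nat set \<Rightarrow> 'k mpoly) \<Rightarrow> nat \<Rightarrow> 'k chain \<Rightarrow> 'k chain" where
  "es_op r \<tau> s 0 x = lift r \<tau> x"
| "es_op r \<tau> s (Suc c) x = (\<lambda>B. es_op r \<tau> s c x B + shift (Suc c) (lift r (s (Suc c)) x) B)"

lemma es_op_eq_sum:
  "es_op r \<tau> s c x B = lift r \<tau> x B + (\<Sum>i\<in>{1..c}. shift i (lift r (s i) x) B)"
  by (induction c) (simp_all add: atLeastAtMostSuc_conv ac_simps)

lemma lift_add: "lift r M (\<lambda>B. x B + y B) = (\<lambda>B. lift r M x B + lift r M y B)"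
  by (rule ext) (simp add: lift_def distrib_right sum.distrib)

lemma lift_diff: "lift r M (\<lambda>B. x B - y B) = (\<lambda>B. lift r M x B - lift r M y B)"
  by (rule ext) (simp add: lift_def left_diff_distrib sum_subtractf)

lemma lift_lift: "lift r M (lift r N x) B = lift r (comp (Pow {1..r}) M N) x B"
proof -
  have "lift r M (lift r N x) B
      = (\<Sum>S'\<in>Pow {1..r}. \<Sum>S\<in>Pow {1..r}. x (fst B, S) * (N S S' * M S' (snd B)))"
    by (simp add: lift_def sum_distrib_right mult.assoc)
  also have "\<dots> = (\<Sum>S\<in>Pow {1..r}. \<Sum>S'\<in>Pow {1..r}. x (fst B, S) * (N S S' * M S' (snd B)))"
    by (rule sum.swap)
  finally show ?thesis by (simp add: lift_def comp_def sum_distrib_left)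
qed

lemma shift_add: "shift i (\<lambda>B. x B + y B) = (\<lambda>B. shift i x B + shift i y B)"
  by (rule ext) (simp add: shift_def)

lemma shift_scale: "shift i (\<lambda>B. p * x B) = (\<lambda>B. p * shift i x B)"
  by (rule ext) (simp add: shift_def)

lemma lift_shift: "lift r M (shift i x) = shift i (lift r M x)"
  by (rule ext) (simp add: shift_def lift_def)

lemma shift_shift: "shift i (shift j x) = shift j (shift i x)"
  by (rule ext) (cases "i = j"; simp add: shift_def fun_upd_twist)

lemma es_op_add: "es_op r \<tau> s c (\<lambda>B. x B + y B) = (\<lambda>B. es_op r \<tau> s c x B + es_op r \<tau> s c y B)"
  by (rule ext) (simp add: es_op_eq_sum lift_add lift_def shift_def distrib_right sum.distrib)

lemma es_op_diff: "es_op r \<tau> s c (\<lambda>B. x B - y B) = (\<lambda>B. es_op r \<tau> s c x B - es_op r \<tau> s c y B)"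
  by (rule ext) (simp add: es_op_eq_sum lift_def shift_def left_diff_distrib sum_subtractf)

lemma es_op_scale: "es_op r \<tau> s c (\<lambda>B. p * x B) = (\<lambda>B. p * es_op r \<tau> s c x B)"
  by (rule ext) (simp add: es_op_eq_sum lift_def shift_def sum_distrib_left distrib_left mult.assoc)

lemma es_op_shift: "es_op r \<tau> s c (shift i x) = shift i (es_op r \<tau> s c x)"
proof (induction c)
  case (Suc c)
  then show ?case
    by (simp add: lift_shift shift_add shift_shift[of "Suc c" i])
qed (simp add: lift_shift)

text \<open>Only the shift in direction \<open>k\<close> relates different values of the \<open>k\<close>-th exponent.\<close>
lemma es_op_local:
  assumes "c < k" "\<And>u S. u k = v k \<Longrightarrow> x (u, S) = y (u, S)"
  shows "es_op r \<tau> s c x (v, T) = es_op r \<tau> s c y (v, T)"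
  using assms by (simp add: es_op_eq_sum lift_def shift_def)

lemma es_op_zero: "es_op r \<tau> s c (\<lambda>_. 0) B = 0"
  by (simp add: es_op_eq_sum lift_def shift_def)

lemma lift_in_ideal:
  assumes "\<And>S T. S \<subseteq> {1..r} \<Longrightarrow> M S T \<in> Qn n" "\<And>B. x B \<in> gen_ideal n J g"
  shows "lift r M x B \<in> gen_ideal n J g"
  unfolding lift_def
  by (intro gen_ideal_sum) (use assms in \<open>auto simp: mult.commute intro: gen_ideal_mult\<close>)

lemma lift_in_Qn:
  assumes "\<And>S T. S \<subseteq> {1..r} \<Longrightarrow> M S T \<in> Qn n" "\<And>B. x B \<in> Qn n"
  shows "lift r M x B \<in> Qn n"
  unfolding lift_def by (intro Qn_sum Qn_mult) (use assms in auto)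

subsection \<open>Chains\<close>

lemma mem_ES_basis:
  "(u, S) \<in> ES_basis r c d \<longleftrightarrow> u \<in> Nc c \<and> S \<subseteq> {1..r} \<and> 2 * absu c u + card S = d"
  by (simp add: ES_basis_def)

lemma ES_chain_iff:
  "ES_chain n r c d x \<longleftrightarrow> (\<forall>B. x B \<in> Qn n) \<and>
     (\<forall>u S. x (u, S) \<noteq> 0 \<longrightarrow> u \<in> Nc c \<and> S \<subseteq> {1..r} \<and> 2 * absu c u + card S = d)"
  unfolding ES_chain_def split_paired_All mem_ES_basis by blast

lemma ES_chainI:
  assumes "\<And>B. x B \<in> Qn n"
    and "\<And>u S. x (u, S) \<noteq> 0 \<Longrightarrow> u \<in> Nc c \<and> S \<subseteq> {1..r} \<and> 2 * absu c u + card S = d"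
  shows "ES_chain n r c d x"
  using assms by (simp add: ES_chain_iff)

lemma ES_chain_in_Qn: "ES_chain n r c d x \<Longrightarrow> x B \<in> Qn n"
  unfolding ES_chain_def by blast

lemma ES_chain_support:
  "ES_chain n r c d x \<Longrightarrow> x (u, S) \<noteq> 0 \<Longrightarrow> u \<in> Nc c \<and> S \<subseteq> {1..r} \<and> 2 * absu c u + card S = d"
  by (simp add: ES_chain_iff)

lemma ES_chain_add:
  assumes "ES_chain n r c d x" "ES_chain n r c d y"
  shows "ES_chain n r c d (\<lambda>B. x B + y B)"
  using assms unfolding ES_chain_def by auto

lemma ES_chain_diff:
  assumes "ES_chain n r c d x" "ES_chain n r c d y"
  shows "ES_chain n r c d (\<lambda>B. x B - y B)"
  using assms unfolding ES_chain_def by auto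

lemma absu_upd:
  assumes "i \<in> {1..c}"
  shows "absu c (u(i := Suc (u i))) = Suc (absu c u)"
proof -
  have "absu c (u(i := k)) = k + (\<Sum>j\<in>{1..c} - {i}. u j)" for k
    unfolding absu_def by (subst sum.remove[OF _ assms]) (auto intro!: sum.cong)
  moreover have "absu c u = u i + (\<Sum>j\<in>{1..c} - {i}. u j)"
    unfolding absu_def by (rule sum.remove) (use assms in auto)
  ultimately show ?thesis by simp
qed

lemma Nc_upd_iff: "i \<in> {1..c} \<Longrightarrow> u(i := k) \<in> Nc c \<longleftrightarrow> u \<in> Nc c"
  unfolding Nc_def by auto

lemma Nc_Suc_iff: "u \<in> Nc c \<longleftrightarrow> u \<in> Nc (Suc c) \<and> u (Suc c) = 0"
  unfolding Nc_def by (auto simp: le_Suc_eq)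

lemma absu_Suc: "u (Suc c) = 0 \<Longrightarrow> absu (Suc c) u = absu c u"
  by (simp add: absu_def)

lemma ES_chain_shift:
  assumes "ES_chain n r c (Suc (Suc d)) x" "i \<in> {1..c}"
  shows "ES_chain n r c d (shift i x)"
proof (rule ES_chainI)
  show "shift i x B \<in> Qn n" for B
    unfolding shift_def by (rule ES_chain_in_Qn[OF assms(1)])
next
  fix u S assume "shift i x (u, S) \<noteq> 0"
  then have "x (u(i := Suc (u i)), S) \<noteq> 0" by (simp add: shift_def)
  from ES_chain_support[OF assms(1) this] show "u \<in> Nc c \<and> S \<subseteq> {1..r} \<and> 2 * absu c u + card S = d"
    unfolding Nc_upd_iff[OF assms(2)] absu_upd[OF assms(2)] by auto
qed

text \<open>The degree condition is additive, so that it covers both the differential, which lowers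
  the size of the subset, and the homotopies, which raise it.\<close>

lemma ES_chain_lift:
  assumes "ES_chain n r c d x"
    and M: "\<And>S T. S \<subseteq> {1..r} \<Longrightarrow> M S T \<in> Qn n"
    and deg: "\<And>S T. S \<subseteq> {1..r} \<Longrightarrow> M S T \<noteq> 0 \<Longrightarrow> T \<subseteq> {1..r} \<and> d + card T = d' + card S"
  shows "ES_chain n r c d' (lift r M x)"
proof (rule ES_chainI)
  show "lift r M x B \<in> Qn n" for B
    by (rule lift_in_Qn[OF M ES_chain_in_Qn[OF assms(1)]])
next
  fix u T assume "lift r M x (u, T) \<noteq> 0"
  then have "(\<Sum>S\<in>Pow {1..r}. x (u, S) * M S T) \<noteq> 0" by (simp add: lift_def)
  then obtain S where S: "S \<in> Pow {1..r}" "x (u, S) * M S T \<noteq> 0"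
    by (rule sum.not_neutral_contains_not_neutral)
  then have "x (u, S) \<noteq> 0" "M S T \<noteq> 0" by auto
  with ES_chain_support[OF assms(1)] deg S(1)
  have "u \<in> Nc c" "2 * absu c u + card S = d" "T \<subseteq> {1..r}" "d + card T = d' + card S" by blast+
  then show "u \<in> Nc c \<and> T \<subseteq> {1..r} \<and> 2 * absu c u + card T = d'" by simp
qed

subsection \<open>Acyclicity of the Eisenbud--Shamash complex\<close>

text \<open>\<open>N\<close> is the total number of homotopies. It stays fixed while the induction
  runs through the operators that use only the first \<open>c\<close> of them.\<close>

locale homotopy_system =
  fixes n r N :: nat
    and \<tau> :: "nat set \<Rightarrow> nat set \<Rightarrow> 'k::field mpoly"
    and s :: "nat \<Rightarrow> nat set \<Rightarrow> nat set \<Rightarrow> 'k mpoly"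
    and a :: "nat \<Rightarrow> 'k mpoly"
  assumes \<tau>_Qn: "S \<subseteq> {1..r} \<Longrightarrow> \<tau> S T \<in> Qn n"
    and s_Qn: "i \<in> {1..N} \<Longrightarrow> S \<subseteq> {1..r} \<Longrightarrow> s i S T \<in> Qn n"
    and a_Qn: "i \<in> {1..N} \<Longrightarrow> a i \<in> Qn n"
    and \<tau>_deg: "S \<subseteq> {1..r} \<Longrightarrow> \<tau> S T \<noteq> 0 \<Longrightarrow> T \<subseteq> {1..r} \<and> card S = Suc (card T)"
    and s_deg: "i \<in> {1..N} \<Longrightarrow> S \<subseteq> {1..r} \<Longrightarrow> s i S T \<noteq> 0 \<Longrightarrow> T \<subseteq> {1..r} \<and> card T = Suc (card S)"
    and \<tau>\<tau>: "S \<subseteq> {1..r} \<Longrightarrow> comp (Pow {1..r}) \<tau> \<tau> S T = 0"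
    and \<tau>s: "i \<in> {1..N} \<Longrightarrow> S \<subseteq> {1..r} \<Longrightarrow>
      comp (Pow {1..r}) \<tau> (s i) S T + comp (Pow {1..r}) (s i) \<tau> S T = (if T = S then a i else 0)"
    and ss: "i \<in> {1..N} \<Longrightarrow> S \<subseteq> {1..r} \<Longrightarrow> comp (Pow {1..r}) (s i) (s i) S T = 0"
    and ss_anticommute: "i \<in> {1..N} \<Longrightarrow> j \<in> {1..N} \<Longrightarrow> S \<subseteq> {1..r} \<Longrightarrow>
      comp (Pow {1..r}) (s i) (s j) S T + comp (Pow {1..r}) (s j) (s i) S T = 0"
begin

abbreviation D :: "nat \<Rightarrow> 'k chain \<Rightarrow> 'k chain" where
  "D \<equiv> es_op r \<tau> s"

abbreviation \<aa> :: "nat \<Rightarrow> 'k mpoly set" where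
  "\<aa> c \<equiv> gen_ideal n {1..c} a"

text \<open>A chain is a function on all pairs, but the operators read only subsets of
  \<open>{1..r}\<close>. The homotopy identity can give back a_i times \<open>x\<close> only if
  \<open>x\<close> vanishes elsewhere.\<close>

definition supported :: "'k chain \<Rightarrow> bool" where
  "supported x \<longleftrightarrow> (\<forall>u S. \<not> S \<subseteq> {1..r} \<longrightarrow> x (u, S) = 0)"

lemma ES_chain_supported: "ES_chain n r c d x \<Longrightarrow> supported x"
  unfolding supported_def using ES_chain_support by blast

lemma lift_eq_0: "(\<And>S T. S \<subseteq> {1..r} \<Longrightarrow> M S T = 0) \<Longrightarrow> lift r M x B = 0"
  by (simp add: lift_def)

lemma lift_s_lift_s: "i \<in> {1..N} \<Longrightarrow> lift r (s i) (lift r (s i) x) B = 0"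
  unfolding lift_lift by (rule lift_eq_0[OF ss])

lemma lift_s_anticommute:
  assumes "i \<in> {1..N}" "j \<in> {1..N}"
  shows "lift r (s i) (lift r (s j) x) B + lift r (s j) (lift r (s i) x) B = 0"
proof -
  have "lift r (s i) (lift r (s j) x) B + lift r (s j) (lift r (s i) x) B
      = (\<Sum>S\<in>Pow {1..r}. x (fst B, S) * (comp (Pow {1..r}) (s i) (s j) S (snd B)
          + comp (Pow {1..r}) (s j) (s i) S (snd B)))"
    unfolding lift_lift by (simp add: lift_def distrib_left sum.distrib)
  also have "\<dots> = 0"
  proof (rule sum.neutral, rule ballI)
    fix S assume "S \<in> Pow {1..r}"
    then show "x (fst B, S) * (comp (Pow {1..r}) (s i) (s j) S (snd B)
          + comp (Pow {1..r}) (s j) (s i) S (snd B)) = 0"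
      by (simp only: ss_anticommute[OF assms] Pow_iff mult_zero_right)
  qed
  finally show ?thesis .
qed

lemma lift_\<tau>_lift_s:
  assumes "i \<in> {1..N}" "supported x"
  shows "lift r \<tau> (lift r (s i) x) B + lift r (s i) (lift r \<tau> x) B = a i * x B"
proof -
  have "lift r \<tau> (lift r (s i) x) B + lift r (s i) (lift r \<tau> x) B
      = (\<Sum>S\<in>Pow {1..r}. x (fst B, S) * (comp (Pow {1..r}) \<tau> (s i) S (snd B)
          + comp (Pow {1..r}) (s i) \<tau> S (snd B)))"
    unfolding lift_lift by (simp add: lift_def distrib_left sum.distrib)
  also have "\<dots> = (\<Sum>S\<in>Pow {1..r}. if S = snd B then a i * x (fst B, S) else 0)"
  proof (rule sum.cong)
    fix S assume "S \<in> Pow {1..r}"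
    then have "comp (Pow {1..r}) \<tau> (s i) S (snd B) + comp (Pow {1..r}) (s i) \<tau> S (snd B)
        = (if snd B = S then a i else 0)"
      by (simp only: \<tau>s[OF assms(1)] Pow_iff)
    then show "x (fst B, S) * (comp (Pow {1..r}) \<tau> (s i) S (snd B) + comp (Pow {1..r}) (s i) \<tau> S (snd B))
        = (if S = snd B then a i * x (fst B, S) else 0)"
      by (simp only: mult.commute mult_zero_right eq_commute[of S] split: if_split) simp
  qed simp
  also have "\<dots> = a i * x B"
    using assms(2) by (cases B) (simp add: supported_def)
  finally show ?thesis .
qed

text \<open>Each homotopy s_k added to the operator contributes t_k (s_k s_j + s_j s_k) = 0, so the
  anticommutator with s_j remains that of tau.\<close>

lemma D_anticommute:
  assumes "c < j" "j \<le> N" "supported x"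
  shows "D c (lift r (s j) x) B + lift r (s j) (D c x) B = a j * x B"
  using assms(1)
proof (induction c)
  case 0
  then show ?case using lift_\<tau>_lift_s[OF _ assms(3), of j] assms(2) by simp
next
  case (Suc c)
  let ?k = "Suc c"
  have jk: "j \<in> {1..N}" "?k \<in> {1..N}" using Suc.prems assms(2) by auto
  have "D ?k (lift r (s j) x) B + lift r (s j) (D ?k x) B
      = (D c (lift r (s j) x) B + lift r (s j) (D c x) B)
        + shift ?k (\<lambda>B. lift r (s ?k) (lift r (s j) x) B + lift r (s j) (lift r (s ?k) x) B) B"
    by (simp add: lift_add lift_shift shift_add)
  also have "(\<lambda>B. lift r (s ?k) (lift r (s j) x) B + lift r (s j) (lift r (s ?k) x) B) = (\<lambda>_. 0)"
    using lift_s_anticommute[OF jk(2,1)] by (rule ext)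
  also have "D c (lift r (s j) x) B + lift r (s j) (D c x) B = a j * x B"
    using Suc by simp
  finally show ?case by (simp add: shift_def)
qed

lemma D_D_0: "D 0 (D 0 x) B = 0"
  unfolding es_op.simps lift_lift by (rule lift_eq_0[OF \<tau>\<tau>])

text \<open>Expanding the square of D + t s gives D D, the mixed term t (D s + s D) = a t, and t t s
  s = 0.\<close>

lemma D_D_Suc:
  assumes "Suc c \<le> N" "supported x"
  shows "D (Suc c) (D (Suc c) x) B = D c (D c x) B + a (Suc c) * shift (Suc c) x B"
proof -
  let ?k = "Suc c"
  have k: "?k \<in> {1..N}" using assms by simp
  have "D ?k (D ?k x) B = D c (D c x) B
      + shift ?k (\<lambda>B. D c (lift r (s ?k) x) B + lift r (s ?k) (D c x) B) B
      + shift ?k (shift ?k (lift r (s ?k) (lift r (s ?k) x))) B"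
    by (simp add: es_op_add es_op_shift lift_add lift_shift shift_add)
  also have "(\<lambda>B. D c (lift r (s ?k) x) B + lift r (s ?k) (D c x) B) = (\<lambda>B. a ?k * x B)"
    using D_anticommute[OF _ assms] by (intro ext) simp
  also have "lift r (s ?k) (lift r (s ?k) x) = (\<lambda>_. 0)"
    using lift_s_lift_s[OF k] by (intro ext)
  finally show ?thesis by (simp add: shift_scale) (simp add: shift_def)
qed

text \<open>Unwinding \<open>D_D_Suc\<close> down to tau tau = 0 shows that the square is the sum of
  the a_i t_i with i up to \<open>c\<close>.\<close>

lemma D_D_mem:
  assumes "c \<le> N" "supported x" "\<And>B. x B \<in> Qn n"
  shows "D c (D c x) B \<in> \<aa> c"
  using assms(1)
proof (induction c)
  case 0
  then show ?case using D_D_0 by simp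
next
  case (Suc c)
  then have "D c (D c x) B \<in> \<aa> c" by simp
  then have "D c (D c x) B \<in> \<aa> (Suc c)"
    using gen_ideal_subset[of "{1..c}" "{1..Suc c}"] by fastforce
  moreover have "shift (Suc c) x B \<in> Qn n" unfolding shift_def by (rule assms(3))
  then have "shift (Suc c) x B * a (Suc c) \<in> \<aa> (Suc c)"
    by (intro gen_ideal_mult gen_ideal_generator) simp_all
  ultimately show ?case
    using gen_ideal_add D_D_Suc[OF Suc.prems assms(2)] by (metis mult.commute)
qed

lemma D_mem:
  assumes "c \<le> N" "\<And>B. x B \<in> gen_ideal n J g"
  shows "D c x B \<in> gen_ideal n J g"
  unfolding es_op_eq_sum shift_def
  by (intro gen_ideal_add gen_ideal_sum lift_in_ideal) (use assms \<tau>_Qn s_Qn in auto)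

lemma lift_s_chain:
  assumes "ES_chain n r c d x" "i \<in> {1..N}"
  shows "ES_chain n r c (Suc d) (lift r (s i) x)"
proof (rule ES_chain_lift[OF assms(1) s_Qn[OF assms(2)]])
  show "T \<subseteq> {1..r} \<and> d + card T = Suc d + card S" if "S \<subseteq> {1..r}" "s i S T \<noteq> 0" for S T
    using s_deg[OF assms(2) that] by simp
qed

lemma D_chain:
  assumes x: "ES_chain n r c (Suc d) x" and "k \<le> c" "c \<le> N"
  shows "ES_chain n r c d (D k x)"
  using assms(2)
proof (induction k)
  case 0
  show ?case unfolding es_op.simps
  proof (rule ES_chain_lift[OF x \<tau>_Qn])
    show "T \<subseteq> {1..r} \<and> Suc d + card T = d + card S" if "S \<subseteq> {1..r}" "\<tau> S T \<noteq> 0" for S T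
      using \<tau>_deg[OF that] by simp
  qed
next
  case (Suc k)
  then have k: "Suc k \<in> {1..N}" "Suc k \<in> {1..c}" using assms(3) by auto
  show ?case unfolding es_op.simps
    by (rule ES_chain_add[OF Suc.IH ES_chain_shift[OF lift_s_chain[OF x k(1)] k(2)]])
      (use Suc.prems in simp)
qed

lemma exact_step:
  assumes kN: "Suc c \<le> N"
    and nzd: "\<And>p. p \<in> Qn n \<Longrightarrow> a (Suc c) * p \<in> \<aa> c \<Longrightarrow> p \<in> \<aa> c"
    and IH: "\<And>x. ES_chain n r c (Suc d) x \<Longrightarrow> (\<And>B. D c x B \<in> \<aa> c) \<Longrightarrow>
      \<exists>y. ES_chain n r c (Suc (Suc d)) y \<and> (\<forall>B. D c y B - x B \<in> \<aa> c)"
    and x: "ES_chain n r (Suc c) (Suc d) x"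
    and cycle: "\<And>B. D (Suc c) x B \<in> \<aa> (Suc c)"
  shows "\<exists>y. ES_chain n r (Suc c) (Suc (Suc d)) y \<and> (\<forall>B. D (Suc c) y B - x B \<in> \<aa> (Suc c))"
proof -
  define k where "k = Suc c"
  note x = x[folded k_def] and cycle = cycle[folded k_def] and nzd = nzd[folded k_def]
  have k: "k \<in> {1..N}" "k \<in> {1..k}" "c < k" "k \<le> N" "c \<le> N" using kN by (auto simp: k_def)
  have Dk: "D k y = (\<lambda>B. D c y B + shift k (lift r (s k) y) B)" for y by (simp add: k_def)
  have x_supp: "supported x" by (rule ES_chain_supported[OF x])
  have Dx: "ES_chain n r k d (D k x)" by (rule D_chain[OF x]) (use k in auto)
  \<comment> \<open>The boundary of \<open>x\<close> is divided by \<open>a k\<close> entry by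
    entry. Off the basis of degree \<open>d\<close> the quotient is chosen to be 0, so that
    \<open>z\<close> is again a chain.\<close>
  have "\<exists>z. z \<in> Qn n \<and> D k x B - a k * z \<in> \<aa> c \<and> (B \<notin> ES_basis r k d \<longrightarrow> z = 0)" for B
  proof (cases "B \<in> ES_basis r k d")
    case True
    then show ?thesis using cycle[of B] unfolding k_def gen_ideal_Suc by blast
  next
    case False
    then have "D k x B = 0" using Dx unfolding ES_chain_def by blast
    then show ?thesis by (intro exI[of _ 0]) simp
  qed
  then obtain z where z: "\<And>B. z B \<in> Qn n" "\<And>B. D k x B - a k * z B \<in> \<aa> c"
    "\<And>B. B \<notin> ES_basis r k d \<Longrightarrow> z B = 0" by metis
  have z_chain: "ES_chain n r k d z" using z by (simp add: ES_chain_def)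
  have z_supp: "supported z" by (rule ES_chain_supported[OF z_chain])
  have sz_chain: "ES_chain n r k (Suc d) (lift r (s k) z)" by (rule lift_s_chain[OF z_chain k(1)])

  have Dz: "D k z B - shift k x B \<in> \<aa> c" for B
  proof (rule nzd)
    have "D k z B \<in> Qn n" unfolding es_op_eq_sum shift_def
      by (intro Qn_add Qn_sum lift_in_Qn) (use k z(1) \<tau>_Qn s_Qn in auto)
    then show "D k z B - shift k x B \<in> Qn n"
      using ES_chain_in_Qn[OF x] by (auto simp: shift_def)
    have "D k (\<lambda>B. D k x B - a k * z B) B \<in> \<aa> c"
      by (rule D_mem[OF k(4) z(2)])
    then have "D k (D k x) B - a k * D k z B \<in> \<aa> c"
      by (simp only: es_op_diff es_op_scale)
    moreover have "D k (D k x) B = D c (D c x) B + a k * shift k x B"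
      unfolding k_def by (rule D_D_Suc[OF kN x_supp])
    moreover have "D c (D c x) B \<in> \<aa> c"
      by (rule D_D_mem[OF k(5) x_supp ES_chain_in_Qn[OF x]])
    ultimately have "D c (D c x) B - (D c (D c x) B + a k * shift k x B - a k * D k z B) \<in> \<aa> c"
      by (simp only: gen_ideal_diff)
    then show "a k * (D k z B - shift k x B) \<in> \<aa> c" by (simp add: algebra_simps)
  qed

  \<comment> \<open>This is what remains of \<open>x\<close> modulo the ideal after subtracting the
    boundary of the lift \<open>z'\<close> of \<open>z\<close> chosen below: that boundary is
    \<open>lift r (s k) z\<close> at exponent 0 and agrees with \<open>x\<close> at positive
    exponents.\<close>
  define w where "w = (\<lambda>B. if fst B k = 0 then x B - lift r (s k) z B else 0)"
  have w_chain: "ES_chain n r c (Suc d) w"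
  proof (rule ES_chainI)
    have xz: "ES_chain n r k (Suc d) (\<lambda>B. x B - lift r (s k) z B)"
      by (rule ES_chain_diff[OF x sz_chain])
    show "w B \<in> Qn n" for B using ES_chain_in_Qn[OF xz, of B] by (simp add: w_def)
    fix u S assume "w (u, S) \<noteq> 0"
    then have "u k = 0" "x (u, S) - lift r (s k) z (u, S) \<noteq> 0" by (auto simp: w_def split: if_splits)
    then show "u \<in> Nc c \<and> S \<subseteq> {1..r} \<and> 2 * absu c u + card S = Suc d"
      using ES_chain_support[OF xz, of u S] by (simp add: k_def Nc_Suc_iff[of u c] absu_Suc)
  qed
  have "D c w B \<in> \<aa> c" for B
  proof (cases "fst B k = 0")
    case False
    have "D c w (fst B, snd B) = D c (\<lambda>_. 0) (fst B, snd B)"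
      by (rule es_op_local[OF k(3)]) (use False in \<open>simp add: w_def\<close>)
    then show ?thesis by (simp add: es_op_zero)
  next
    case True
    have "D c w (fst B, snd B) = D c (\<lambda>B. x B - lift r (s k) z B) (fst B, snd B)"
      by (rule es_op_local[OF k(3)]) (use True in \<open>simp add: w_def\<close>)
    then have 1: "D c w B = D c x B - D c (lift r (s k) z) B" by (simp add: es_op_diff)
    have 2: "D c (lift r (s k) z) B + lift r (s k) (D c z) B = a k * z B"
      by (rule D_anticommute[OF k(3,4) z_supp])
    have "shift k (lift r (s k) (lift r (s k) z)) B = 0"
      unfolding shift_def by (rule lift_s_lift_s[OF k(1)])
    then have 3: "lift r (s k) (D k z) B = lift r (s k) (D c z) B"
      by (simp add: Dk lift_add lift_shift)
    have 4: "lift r (s k) (\<lambda>B. D k z B - shift k x B) B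
        = lift r (s k) (D k z) B - shift k (lift r (s k) x) B"
      by (simp add: lift_diff lift_shift)
    have 5: "D k x B = D c x B + shift k (lift r (s k) x) B" by (simp add: Dk)
    \<comment> \<open>The first bracket lies in the ideal by the choice of \<open>z\<close>, the
      second term by applying s_k to the congruence \<open>Dz\<close>.\<close>
    have "D c w B = (D k x B - a k * z B) + lift r (s k) (\<lambda>B. D k z B - shift k x B) B"
      unfolding 1 4 3 5 2[symmetric] by simp
    moreover have "lift r (s k) (\<lambda>B. D k z B - shift k x B) B \<in> \<aa> c"
      by (rule lift_in_ideal[OF _ Dz]) (rule s_Qn[OF k(1)])
    ultimately show ?thesis using gen_ideal_add[OF z(2)] by metis
  qed
  then obtain y0 where y0: "ES_chain n r c (Suc (Suc d)) y0" "\<And>B. D c y0 B - w B \<in> \<aa> c"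
    using IH[OF w_chain] by blast

  \<comment> \<open>The right inverse of t_k that raises y_k^(p) to y_k^(p+1). Having no part at
    exponent 0, it makes \<open>D c z'\<close> vanish there.\<close>
  define z' where "z' = (\<lambda>B. if fst B k = 0 then 0 else z ((fst B)(k := fst B k - 1), snd B))"
  have shift_z': "shift k z' = z" by (rule ext) (simp add: z'_def shift_def)
  have z'_chain: "ES_chain n r k (Suc (Suc d)) z'"
  proof (rule ES_chainI)
    show "z' B \<in> Qn n" for B using z(1) by (simp add: z'_def)
    fix u S assume *: "z' (u, S) \<noteq> 0"
    define u' where "u' = u(k := u k - 1)"
    from * have u: "u = u'(k := Suc (u' k))" and "z (u', S) \<noteq> 0"
      by (auto simp: z'_def u'_def split: if_splits)
    then have "u' \<in> Nc k \<and> S \<subseteq> {1..r} \<and> 2 * absu k u' + card S = d"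
      using ES_chain_support[OF z_chain] by blast
    then show "u \<in> Nc k \<and> S \<subseteq> {1..r} \<and> 2 * absu k u + card S = Suc (Suc d)"
      unfolding u using k(2) by (simp only: Nc_upd_iff absu_upd) simp
  qed
  have y0_chain: "ES_chain n r k (Suc (Suc d)) y0"
  proof (rule ES_chainI)
    show "y0 B \<in> Qn n" for B by (rule ES_chain_in_Qn[OF y0(1)])
    fix u S assume "y0 (u, S) \<noteq> 0"
    from ES_chain_support[OF y0(1) this]
    show "u \<in> Nc k \<and> S \<subseteq> {1..r} \<and> 2 * absu k u + card S = Suc (Suc d)"
      by (simp add: k_def Nc_Suc_iff[of u c] absu_Suc)
  qed
  \<comment> \<open>The congruence holds already modulo the smaller ideal. This is consistent: there
    \<open>D k x\<close> is a_k times \<open>z\<close>, just as D_k D_k sends the constructed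
    element to a_k t_k of it, which is a_k times \<open>z\<close>.\<close>
  have "D k (\<lambda>B. y0 B + z' B) B - x B \<in> \<aa> c" for B
  proof -
    have "y0 (u, S) = 0" if "u k \<noteq> 0" for u S
      using ES_chain_support[OF y0(1), of u S] that by (auto simp: k_def Nc_Suc_iff[of u c])
    then have "shift k (lift r (s k) y0) B = 0" by (simp add: shift_def lift_def)
    then have 1: "D k (\<lambda>B. y0 B + z' B) B = D c y0 B + D k z' B"
      by (simp add: es_op_add Dk lift_add shift_add)
    show ?thesis
    proof (cases "fst B k = 0")
      case True
      have "D c z' (fst B, snd B) = D c (\<lambda>_. 0) (fst B, snd B)"
        by (rule es_op_local[OF k(3)]) (use True in \<open>simp add: z'_def\<close>)
      then have "D k z' B = lift r (s k) z B"
        by (simp add: Dk es_op_zero lift_shift[symmetric] shift_z')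
      then have "D k (\<lambda>B. y0 B + z' B) B - x B = D c y0 B - w B"
        using True 1 by (simp add: w_def)
      then show ?thesis using y0(2) by simp
    next
      case False
      \<comment> \<open>An entry at positive exponent is an entry of the shifted chain one step
        lower, where \<open>Dz\<close> applies.\<close>
      define B' where "B' = ((fst B)(k := fst B k - 1), snd B)"
      have shift_B': "shift k y B' = y B" for y :: "'k chain"
        using False by (simp add: shift_def B'_def)
      have "D k z' B = shift k (D k z') B'" by (simp add: shift_B')
      also have "\<dots> = D k z B'" by (simp add: es_op_shift[symmetric] shift_z')
      finally have "D k (\<lambda>B. y0 B + z' B) B - x B = (D c y0 B - w B) + (D k z B' - shift k x B')"
        using False 1 by (simp add: w_def shift_B')
      then show ?thesis using gen_ideal_add[OF y0(2) Dz] by simp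
    qed
  qed
  moreover have "\<aa> c \<subseteq> \<aa> (Suc c)" by (rule gen_ideal_subset) auto
  ultimately show ?thesis
    using ES_chain_add[OF y0_chain z'_chain] unfolding k_def by blast
qed

lemma exact:
  assumes nzd: "\<And>i p. i \<in> {1..N} \<Longrightarrow> p \<in> Qn n \<Longrightarrow> a i * p \<in> gen_ideal n {1..<i} a \<Longrightarrow>
      p \<in> gen_ideal n {1..<i} a"
    and acyclic: "\<And>d x. (\<And>S. x S \<in> Qn n) \<Longrightarrow> (\<And>S. x S \<noteq> 0 \<Longrightarrow> S \<subseteq> {1..r} \<and> card S = Suc d) \<Longrightarrow>
      (\<And>T. (\<Sum>S\<in>Pow {1..r}. x S * \<tau> S T) = 0) \<Longrightarrow>
      \<exists>y. (\<forall>S. y S \<in> Qn n) \<and> (\<forall>S. y S \<noteq> 0 \<longrightarrow> S \<subseteq> {1..r} \<and> card S = Suc (Suc d)) \<and>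
        (\<forall>T. (\<Sum>S\<in>Pow {1..r}. y S * \<tau> S T) = x T)"
    and "c \<le> N" "ES_chain n r c (Suc d) x" "\<And>B. D c x B \<in> \<aa> c"
  shows "\<exists>y. ES_chain n r c (Suc (Suc d)) y \<and> (\<forall>B. D c y B - x B \<in> \<aa> c)"
  using assms(3-5)
proof (induction c arbitrary: d x)
  case 0
  \<comment> \<open>Without homotopies only the zero exponent and the zero ideal are left, so the
    congruences become equalities in the complex of tau.\<close>
  have Nc0: "u \<in> Nc 0 \<longleftrightarrow> u = (\<lambda>_. 0)" for u by (auto simp: Nc_def)
  have absu0: "absu 0 u = 0" for u by (simp add: absu_def)
  define X where "X S = x (\<lambda>_. 0, S)" for S
  have "\<exists>y. (\<forall>S. y S \<in> Qn n) \<and> (\<forall>S. y S \<noteq> 0 \<longrightarrow> S \<subseteq> {1..r} \<and> card S = Suc (Suc d)) \<and>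
        (\<forall>T. (\<Sum>S\<in>Pow {1..r}. y S * \<tau> S T) = X T)"
  proof (rule acyclic)
    show "X S \<in> Qn n" for S unfolding X_def by (rule ES_chain_in_Qn[OF 0(2)])
    show "S \<subseteq> {1..r} \<and> card S = Suc d" if "X S \<noteq> 0" for S
      using ES_chain_support[OF 0(2) that[unfolded X_def]] by (simp add: absu0)
    show "(\<Sum>S\<in>Pow {1..r}. X S * \<tau> S T) = 0" for T
      using 0(3)[of "(\<lambda>_. 0, T)"] by (simp add: lift_def X_def)
  qed
  then obtain Y where Y: "\<And>S. Y S \<in> Qn n" "\<And>S. Y S \<noteq> 0 \<Longrightarrow> S \<subseteq> {1..r} \<and> card S = Suc (Suc d)"
    "\<And>T. (\<Sum>S\<in>Pow {1..r}. Y S * \<tau> S T) = X T" by blast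
  define y :: "'k chain" where "y B = (if fst B = (\<lambda>_. 0) then Y (snd B) else 0)" for B
  have "ES_chain n r 0 (Suc (Suc d)) y"
    by (rule ES_chainI) (use Y in \<open>auto simp: y_def Nc0 absu0 split: if_splits\<close>)
  moreover have "D 0 y B - x B \<in> \<aa> 0" for B
  proof (cases "fst B = (\<lambda>_. 0)")
    case True
    then show ?thesis using Y(3)[of "snd B"] by (cases B) (simp add: lift_def y_def X_def)
  next
    case False
    then have "x B = 0" using ES_chain_support[OF 0(2), of "fst B" "snd B"] Nc0 by auto
    with False show ?thesis by (simp add: lift_def y_def)
  qed
  ultimately show ?case by blast
next
  case (Suc c)
  show ?case
  proof (rule exact_step[OF Suc.prems(1) _ _ Suc.prems(2,3)])
    show "p \<in> \<aa> c" if "p \<in> Qn n" "a (Suc c) * p \<in> \<aa> c" for p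
      using nzd[of "Suc c" p] that Suc.prems(1) by (simp add: atLeastLessThanSuc_atLeastAtMost)
    show "\<exists>y. ES_chain n r c (Suc (Suc d)) y \<and> (\<forall>B. D c y B - x B \<in> \<aa> c)"
      if "ES_chain n r c (Suc d) x" "\<And>B. D c x B \<in> \<aa> c" for x
      using Suc.IH[OF _ that] Suc.prems(1) by simp
  qed
qed

end

subsection \<open>The system of homotopies\<close>

lemma unit_vec_eq_iff [simp]: "unit_vec i = unit_vec j \<longleftrightarrow> i = j"
  by (auto simp: unit_vec_def fun_eq_iff split: if_splits)

lemma unit_vec_nonzero [simp]: "unit_vec i \<noteq> (\<lambda>_. 0)"
  by (auto simp: unit_vec_def fun_eq_iff)

lemma unit_vec_in_Nc: "i \<in> {1..c} \<Longrightarrow> unit_vec i \<in> Nc c"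
  by (auto simp: unit_vec_def Nc_def)

lemma absu_unit_vec: "i \<in> {1..c} \<Longrightarrow> absu c (unit_vec i) = 1"
  by (simp add: absu_def unit_vec_def)

lemma sigma_sys_0: "sigma_sys \<alpha> f r c (\<lambda>_. 0) = taylor_diff \<alpha> r"
  by (simp add: sigma_sys_def)

lemma sigma_sys_unit_vec:
  assumes "i \<in> {1..c}"
  shows "sigma_sys \<alpha> f r c (unit_vec i) = sigma_e \<alpha> f r i"
proof -
  have "(THE j. j \<in> {1..c} \<and> unit_vec i = unit_vec j) = i"
    by (rule the_equality) (use assms in auto)
  moreover have "\<exists>j\<in>{1..c}. unit_vec i = unit_vec j" using assms by blast
  ultimately show ?thesis unfolding sigma_sys_def by (simp only: unit_vec_nonzero if_False if_True)
qed

lemma sigma_sys_nonzeroD: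
  assumes "sigma_sys \<alpha> f r c u S T \<noteq> 0"
  shows "u = (\<lambda>_. 0) \<or> (\<exists>i\<in>{1..c}. u = unit_vec i)"
  using assms unfolding sigma_sys_def by presburger

lemma taylor_diff_degree:
  assumes "taylor_diff \<alpha> r S T \<noteq> (0 :: 'k::field mpoly)"
  shows "T \<subseteq> {1..r} \<and> card S = Suc (card T)"
proof -
  from assms have "raise r (taylor_coef \<alpha>) T S \<noteq> (0 :: 'k mpoly)" by (simp only: taylor_diff_eq_raise not_False_eq_True)
  then obtain t where t: "T \<subseteq> {1..r}" "t \<in> {1..r} - T" "S = insert t T" by (rule raise_nonzeroD)
  then have "finite T" using finite_subset by blast
  with t show ?thesis by simp
qed

lemma sigma_e_degree:
  assumes "sigma_e \<alpha> f r i S T \<noteq> (0 :: 'k::field mpoly)"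
  shows "T \<subseteq> {1..r} \<and> card T = Suc (card S)"
proof -
  from assms have "raise r (homotopy_coef \<alpha> (f i)) S T \<noteq> (0 :: 'k mpoly)" by (simp only: sigma_e_eq_raise not_False_eq_True)
  then obtain t where t: "S \<subseteq> {1..r}" "t \<in> {1..r} - S" "T = insert t S" by (rule raise_nonzeroD)
  then have "finite S" using finite_subset by blast
  with t show ?thesis by simp
qed

lemma raise_in_Qn:
  assumes "\<And>t. S \<subseteq> {1..r} \<Longrightarrow> t \<in> {1..r} \<Longrightarrow> g S t \<in> Qn n"
  shows "raise r g S T \<in> Qn n"
proof (cases "S \<subseteq> {1..r}")
  case True
  have "(\<Sum>t\<in>{1..r} - S. if T = insert t S then sg S t * g S t else 0) \<in> Qn n"
    by (rule Qn_sum) (use assms[OF True] in \<open>simp add: Qn_mult\<close>)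
  then show ?thesis using True by (simp only: raise_def if_True)
qed (simp add: raise_def)

lemma ES_diff_same: "ES_diff (sigma_sys \<alpha> f r c) (v, S) (v, T) = taylor_diff \<alpha> r S T"
  by (simp add: ES_diff_def sigma_sys_0)

lemma ES_diff_upd:
  assumes "i \<in> {1..c}"
  shows "ES_diff (sigma_sys \<alpha> f r c) (v(i := Suc (v i)), S) (v, T) = sigma_e \<alpha> f r i S T"
proof -
  have "(\<lambda>j. (v(i := Suc (v i))) j - v j) = unit_vec i" by (auto simp: unit_vec_def)
  then show ?thesis using sigma_sys_unit_vec[OF assms, of \<alpha> f r] by (simp add: ES_diff_def)
qed

text \<open>Since sigma is nonzero only at the zero vector and at unit vectors, at most one exponent
  drops, by one. The pointwise inequality comes first because truncated subtraction would hide
  negative differences.\<close>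

lemma ES_diff_nonzeroD:
  assumes "ES_diff (sigma_sys \<alpha> f r c) (u, S) (v, T) \<noteq> 0"
  shows "u = v \<or> (\<exists>i\<in>{1..c}. u = v(i := Suc (v i)))"
proof -
  have le: "\<forall>j. v j \<le> u j"
  proof (rule ccontr)
    assume n: "\<not> (\<forall>j. v j \<le> u j)"
    from assms show False unfolding ES_diff_def prod.case if_not_P[OF n] by simp
  qed
  then have "sigma_sys \<alpha> f r c (\<lambda>i. u i - v i) S T \<noteq> 0"
    using assms by (simp add: ES_diff_def)
  from sigma_sys_nonzeroD[OF this] show ?thesis
  proof
    assume "(\<lambda>i. u i - v i) = (\<lambda>_. 0)"
    then have "u = v" using le by (simp add: fun_eq_iff le_antisym)
    then show ?thesis ..
  next
    assume "\<exists>i\<in>{1..c}. (\<lambda>i. u i - v i) = unit_vec i"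
    then obtain i where i: "i \<in> {1..c}" "(\<lambda>i. u i - v i) = unit_vec i" by blast
    have "u j = (v(i := Suc (v i))) j" for j
      using fun_cong[OF i(2), of j] spec[OF le, of j] by (auto simp: unit_vec_def split: if_splits)
    with i(1) show ?thesis by blast
  qed
qed

lemma finite_bounded_Nc: "finite {u \<in> Nc c. \<forall>i. u i \<le> w i}"
proof (rule finite_subset)
  show "{u \<in> Nc c. \<forall>i. u i \<le> w i}
      \<subseteq> {u. \<forall>i. (i \<in> {1..c} \<longrightarrow> u i \<in> {..\<Sum>j\<in>{1..c}. w j}) \<and> (i \<notin> {1..c} \<longrightarrow> u i = 0)}"
  proof (intro subsetI CollectI allI conjI impI)
    fix u i assume "u \<in> {u \<in> Nc c. \<forall>i. u i \<le> w i}"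
    then have u: "u \<in> Nc c" "u i \<le> w i" by auto
    show "u i = 0" if "i \<notin> {1..c}" using u that by (simp add: Nc_def)
    show "u i \<in> {..\<Sum>j\<in>{1..c}. w j}" if "i \<in> {1..c}"
      using member_le_sum[OF that, of w] u(2) by simp
  qed
  show "finite {u :: nat \<Rightarrow> nat. \<forall>i. (i \<in> {1..c} \<longrightarrow> u i \<in> {..\<Sum>j\<in>{1..c}. w j}) \<and> (i \<notin> {1..c} \<longrightarrow> u i = 0)}"
    by (rule finite_set_of_finite_funs) simp_all
qed

lemma finite_ES_basis: "finite (ES_basis r c d)"
proof (rule finite_subset)
  show "ES_basis r c d \<subseteq> {u \<in> Nc c. \<forall>i. u i \<le> d} \<times> Pow {1..r}"
  proof
    fix B assume "B \<in> ES_basis r c d"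
    then obtain u S where B: "B = (u, S)" "u \<in> Nc c" "S \<subseteq> {1..r}" "2 * absu c u + card S = d"
      by (auto simp: ES_basis_def)
    have "u i \<le> d" for i
    proof (cases "i \<in> {1..c}")
      case True
      then have "u i \<le> absu c u" unfolding absu_def by (intro member_le_sum) auto
      with B(4) show ?thesis by simp
    next
      case False
      with B(2) show ?thesis by (simp add: Nc_def)
    qed
    with B show "B \<in> {u \<in> Nc c. \<forall>i. u i \<le> d} \<times> Pow {1..r}" by simp
  qed
  show "finite ({u \<in> Nc c. \<forall>i. u i \<le> d} \<times> Pow {1..r})"
    using finite_bounded_Nc[of c "\<lambda>_. d"] by simp
qed

section \<open>The Taylor data as an instance of the abstract homotopy system\<close>

locale taylor_homotopies =
  fixes n r c :: nat
    and \<alpha> :: "nat \<Rightarrow> expo"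
    and a :: "nat \<Rightarrow> 'k::field mpoly"
    and f :: "nat \<Rightarrow> nat \<Rightarrow> 'k mpoly"
  assumes mon: "\<forall>j\<in>{1..r}. Poly_Mapping.keys (\<alpha> j) \<subseteq> {..<n}"
    and aQ: "\<forall>i\<in>{1..c}. a i \<in> Qn n"
    and fQ: "\<forall>i\<in>{1..c}. \<forall>j\<in>{1..r}. f i j \<in> Qn n"
    and af: "\<forall>i\<in>{1..c}. a i = (\<Sum>j\<in>{1..r}. f i j * mono (\<alpha> j))"
begin

lemma keys_lcm: "S \<subseteq> {1..r} \<Longrightarrow> Poly_Mapping.keys (lcm_exp \<alpha> S) \<subseteq> {..<n}"
  by (rule keys_lcm_exp) (use mon finite_subset in \<open>blast+\<close>)

lemma taylor_diff_in_Qn: "taylor_diff \<alpha> r S T \<in> Qn n"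
  unfolding taylor_diff_eq_raise
proof (rule raise_in_Qn)
  fix t assume "T \<subseteq> {1..r}" "t \<in> {1..r}"
  then have "Poly_Mapping.keys (lcm_exp \<alpha> (insert t T)) \<subseteq> {..<n}" by (intro keys_lcm) auto
  moreover have "Poly_Mapping.keys (lcm_exp \<alpha> (insert t T) - lcm_exp \<alpha> T)
      \<subseteq> Poly_Mapping.keys (lcm_exp \<alpha> (insert t T))"
    by (auto simp: in_keys_iff lookup_minus_expo)
  ultimately show "taylor_coef \<alpha> T t \<in> Qn n"
    unfolding taylor_coef_def by (intro Qn_mono) blast
qed

lemma sigma_e_in_Qn:
  assumes "i \<in> {1..c}"
  shows "sigma_e \<alpha> f r i S T \<in> Qn n"
  unfolding sigma_e_eq_raise
proof (rule raise_in_Qn)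
  fix t assume t: "S \<subseteq> {1..r}" "t \<in> {1..r}"
  have "Poly_Mapping.keys (\<alpha> t + lcm_exp \<alpha> S - lcm_exp \<alpha> (insert t S))
      \<subseteq> Poly_Mapping.keys (\<alpha> t) \<union> Poly_Mapping.keys (lcm_exp \<alpha> S)"
    by (auto simp: in_keys_iff lookup_add lookup_minus_expo)
  with keys_lcm[OF t(1)] mon t(2)
  have "Poly_Mapping.keys (\<alpha> t + lcm_exp \<alpha> S - lcm_exp \<alpha> (insert t S)) \<subseteq> {..<n}" by blast
  then show "homotopy_coef \<alpha> (f i) S t \<in> Qn n"
    unfolding homotopy_coef_def using fQ assms t(2) by (intro Qn_mult Qn_mono) auto
qed

lemma comp_taylor_sigma_eq:
  assumes "i \<in> {1..c}" "S \<subseteq> {1..r}"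
  shows "comp (Pow {1..r}) (taylor_diff \<alpha> r) (sigma_e \<alpha> f r i) S T
    + comp (Pow {1..r}) (sigma_e \<alpha> f r i) (taylor_diff \<alpha> r) S T = (if T = S then a i else 0)"
  unfolding comp_taylor_sigma[OF assms(2)] using af assms(1) by simp

lemma comp_taylor_taylor: "comp (Pow {1..r}) (taylor_diff \<alpha> r) (taylor_diff \<alpha> r) S T = (0 :: 'k mpoly)"
proof (cases "T \<subseteq> {1..r}")
  case True
  then show ?thesis by (rule comp_taylor_diff)
next
  case False
  then show ?thesis by (simp add: comp_def taylor_diff_outside)
qed

sublocale homotopy_system n r c "taylor_diff \<alpha> r" "sigma_e \<alpha> f r" a
proof
  show "taylor_diff \<alpha> r S T \<in> Qn n" for S T by (rule taylor_diff_in_Qn)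
  show "sigma_e \<alpha> f r i S T \<in> Qn n" if "i \<in> {1..c}" for i S T by (rule sigma_e_in_Qn[OF that])
  show "a i \<in> Qn n" if "i \<in> {1..c}" for i using aQ that by blast
  show "T \<subseteq> {1..r} \<and> card S = Suc (card T)" if "taylor_diff \<alpha> r S T \<noteq> (0 :: 'k mpoly)" for S T
    by (rule taylor_diff_degree[OF that])
  show "T \<subseteq> {1..r} \<and> card T = Suc (card S)" if "sigma_e \<alpha> f r i S T \<noteq> 0" for i S T
    by (rule sigma_e_degree[OF that])
  show "comp (Pow {1..r}) (taylor_diff \<alpha> r) (taylor_diff \<alpha> r) S T = (0 :: 'k mpoly)" for S T
    by (rule comp_taylor_taylor)
  show "comp (Pow {1..r}) (taylor_diff \<alpha> r) (sigma_e \<alpha> f r i) S T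
    + comp (Pow {1..r}) (sigma_e \<alpha> f r i) (taylor_diff \<alpha> r) S T = (if T = S then a i else 0)"
    if "i \<in> {1..c}" "S \<subseteq> {1..r}" for i S T by (rule comp_taylor_sigma_eq[OF that])
  show "comp (Pow {1..r}) (sigma_e \<alpha> f r i) (sigma_e \<alpha> f r i) S T = 0" if "S \<subseteq> {1..r}" for i S T
    by (rule comp_sigma_e_self[OF that])
  show "comp (Pow {1..r}) (sigma_e \<alpha> f r i) (sigma_e \<alpha> f r j) S T
        + comp (Pow {1..r}) (sigma_e \<alpha> f r j) (sigma_e \<alpha> f r i) S T = 0" if "S \<subseteq> {1..r}" for i j S T
    by (rule comp_sigma_e_anticommute[OF that])
qed

abbreviation \<sigma> :: "(nat \<Rightarrow> nat) \<Rightarrow> nat set \<Rightarrow> nat set \<Rightarrow> 'k mpoly" where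
  "\<sigma> \<equiv> sigma_sys \<alpha> f r c"

lemma sigma_sys_degree:
  assumes "\<sigma> u S T \<noteq> 0"
  shows "T \<subseteq> {1..r} \<and> int (card T) = int (card S) + 2 * int (absu c u) - 1 \<and> \<sigma> u S T \<in> Qn n"
  using sigma_sys_nonzeroD[OF assms]
proof
  assume u: "u = (\<lambda>_. 0)"
  then have "absu c u = 0" by (simp add: absu_def)
  with assms taylor_diff_degree[of \<alpha> r S T, where ?'k = 'k] taylor_diff_in_Qn[of S T] show ?thesis
    unfolding u sigma_sys_0 by simp
next
  assume "\<exists>i\<in>{1..c}. u = unit_vec i"
  then obtain i where i: "i \<in> {1..c}" "u = unit_vec i" by blast
  with assms sigma_e_degree[of \<alpha> f r i S T] sigma_e_in_Qn[OF i(1), of S T] absu_unit_vec[OF i(1)]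
  show ?thesis unfolding i(2) sigma_sys_unit_vec[OF i(1)] by simp
qed

text \<open>In a nonzero summand both \<open>b\<close> and \<open>u - b\<close> have size at most 1
  while their sizes add up to at least 2, so both are unit vectors. At most two summands survive,
  and they are the two orders of composition.\<close>

lemma sigma_sys_convolution:
  assumes u: "2 \<le> absu c u" and S: "S \<subseteq> {1..r}"
  shows "(\<Sum>b\<in>{b\<in>Nc c. \<forall>i. b i \<le> u i}. comp (Pow {1..r}) (\<sigma> b) (\<sigma> (\<lambda>i. u i - b i)) S T) = 0"
    (is "sum ?Z ?X = 0")
proof -
  have nonzero: "\<exists>i\<in>{1..c}. \<exists>j\<in>{1..c}. b = unit_vec i \<and> u = (\<lambda>k. unit_vec i k + unit_vec j k)"
    if b: "b \<in> ?X" "?Z b \<noteq> 0" for b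
  proof -
    have le: "b k \<le> u k" for k using b(1) by simp
    from b(2) have "(\<Sum>S'\<in>Pow {1..r}. \<sigma> (\<lambda>i. u i - b i) S S' * \<sigma> b S' T) \<noteq> 0" by (simp only: comp_def not_False_eq_True)
    then obtain S' where "\<sigma> (\<lambda>i. u i - b i) S S' * \<sigma> b S' T \<noteq> 0"
      by (rule sum.not_neutral_contains_not_neutral)
    then have "\<sigma> (\<lambda>i. u i - b i) S S' \<noteq> 0" "\<sigma> b S' T \<noteq> 0" by auto
    then have cases: "(\<lambda>i. u i - b i) = (\<lambda>_. 0) \<or> (\<exists>j\<in>{1..c}. (\<lambda>i. u i - b i) = unit_vec j)"
      "b = (\<lambda>_. 0) \<or> (\<exists>i\<in>{1..c}. b = unit_vec i)"
      using sigma_sys_nonzeroD by blast+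
    have absu: "absu c u = absu c (\<lambda>i. u i - b i) + absu c b"
      unfolding absu_def sum.distrib[symmetric] using le by (intro sum.cong) auto
    have small: "absu c w \<le> 1" if "w = (\<lambda>_. 0) \<or> (\<exists>i\<in>{1..c}. w = unit_vec i)" for w
      using that absu_unit_vec by (auto simp: absu_def)
    have "absu c b \<noteq> 0" "absu c (\<lambda>i. u i - b i) \<noteq> 0"
      using absu u small[OF cases(1)] small[OF cases(2)] by linarith+
    moreover have "absu c (\<lambda>_. 0) = 0" by (simp add: absu_def)
    ultimately have "b \<noteq> (\<lambda>_. 0)" "(\<lambda>i. u i - b i) \<noteq> (\<lambda>_. 0)" by metis+
    with cases obtain i j where ij: "i \<in> {1..c}" "b = unit_vec i" "j \<in> {1..c}" "(\<lambda>i. u i - b i) = unit_vec j"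
      by blast
    have "u k = unit_vec i k + unit_vec j k" for k
      using le[of k] ij(2) fun_cong[OF ij(4), of k] by simp
    with ij show ?thesis by blast
  qed
  show ?thesis
  proof (cases "\<exists>i\<in>{1..c}. \<exists>j\<in>{1..c}. u = (\<lambda>k. unit_vec i k + unit_vec j k)")
    case False
    show ?thesis
    proof (rule sum.neutral, rule ballI, rule ccontr)
      fix b assume "b \<in> ?X" "?Z b \<noteq> 0"
      with False nonzero show False by blast
    qed
  next
    case True
    then obtain i j where ij: "i \<in> {1..c}" "j \<in> {1..c}" "u = (\<lambda>k. unit_vec i k + unit_vec j k)" by blast
    have X: "{unit_vec i, unit_vec j} \<subseteq> ?X"
      using ij unit_vec_in_Nc by auto
    have "b \<in> {unit_vec i, unit_vec j}" if b: "b \<in> ?X" "?Z b \<noteq> 0" for b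
    proof -
      obtain k l where k: "b = unit_vec k" "u = (\<lambda>m. unit_vec k m + unit_vec l m)"
        using nonzero[OF b] by blast
      \<comment> \<open>Coordinate \<open>k\<close> is positive on the right, so \<open>k\<close>
        must be \<open>i\<close> or \<open>j\<close>.\<close>
      have "unit_vec i k + unit_vec j k = unit_vec k k + unit_vec l k"
        using fun_cong[OF k(2), of k] ij(3) by simp
      then have "k = i \<or> k = j" by (auto simp: unit_vec_def split: if_splits)
      with k(1) show ?thesis by blast
    qed
    then have "sum ?Z ?X = sum ?Z {unit_vec i, unit_vec j}"
      by (intro sum.mono_neutral_right finite_bounded_Nc X) blast
    also have "\<dots> = 0"
    proof -
      have "(\<lambda>k. u k - unit_vec i k) = unit_vec j" "(\<lambda>k. u k - unit_vec j k) = unit_vec i"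
        using ij(3) by auto
      then have Z: "?Z (unit_vec i) = comp (Pow {1..r}) (sigma_e \<alpha> f r i) (sigma_e \<alpha> f r j) S T"
        "?Z (unit_vec j) = comp (Pow {1..r}) (sigma_e \<alpha> f r j) (sigma_e \<alpha> f r i) S T"
        unfolding sigma_sys_unit_vec[OF ij(1), symmetric] sigma_sys_unit_vec[OF ij(2), symmetric] by simp_all
      show ?thesis
      \<comment> \<open>For \<open>i = j\<close> the two summands coincide and are counted once, so
        the square itself has to vanish; the anticommutator would only control twice the
        square.\<close>
      proof (cases "i = j")
        case True
        then show ?thesis using Z comp_sigma_e_self[OF S] by simp
      next
        case False
        then have "sum ?Z {unit_vec i, unit_vec j} = ?Z (unit_vec i) + ?Z (unit_vec j)" by simp
        then show ?thesis unfolding Z comp_sigma_e_anticommute[OF S] .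
      qed
    qed
    finally show ?thesis .
  qed
qed

lemma is_HHS_sigma_sys: "is_HHS n c a (Pow {1..r}) card (taylor_diff \<alpha> r) \<sigma>"
  unfolding is_HHS_def
proof (intro conjI ballI allI impI)
  fix u S T assume "\<sigma> u S T \<noteq> 0"
  from sigma_sys_degree[OF this]
  show "T \<in> Pow {1..r}" "int (card T) = int (card S) + 2 * int (absu c u) - 1" "\<sigma> u S T \<in> Qn n"
    by blast+
next
  fix S T show "\<sigma> (\<lambda>_. 0) S T = taylor_diff \<alpha> r S T" by (simp only: sigma_sys_0)
next
  fix j S T assume "j \<in> {1..c}" "S \<in> Pow {1..r}"
  then show "comp (Pow {1..r}) (\<sigma> (\<lambda>_. 0)) (\<sigma> (unit_vec j)) S T
      + comp (Pow {1..r}) (\<sigma> (unit_vec j)) (\<sigma> (\<lambda>_. 0)) S T = (if T = S then a j else 0)"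
    by (simp only: sigma_sys_0 sigma_sys_unit_vec comp_taylor_sigma_eq Pow_iff)
next
  fix u S T assume "2 \<le> absu c u" "S \<in> Pow {1..r}"
  then show "(\<Sum>b\<in>{b\<in>Nc c. \<forall>i. b i \<le> u i}. comp (Pow {1..r}) (\<sigma> b) (\<sigma> (\<lambda>i. u i - b i)) S T) = 0"
    by (intro sigma_sys_convolution) auto
qed

subsection \<open>The Eisenbud--Shamash complex of the Taylor complex\<close>

text \<open>The two sides sum over different index sets. The sources with an entry into exponent v
  are v and the v + e_i, so other basis elements have zero matrix entries; pairs of the wrong degree
  have zero coefficient in \<open>x\<close>.\<close>

lemma ES_apply_eq:
  assumes x: "ES_chain n r c d x"
  shows "ES_apply r c d (ES_diff \<sigma>) x = D c x"
proof
  fix B :: "(nat \<Rightarrow> nat) \<times> nat set"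
  obtain v T where B: "B = (v, T)" by (cases B)
  define up where "up i = v(i := Suc (v i))" for i
  define F where "F = insert v (up ` {1..c})"
  have up: "v \<noteq> up i" "up i = up j \<longleftrightarrow> i = j" for i j
    unfolding up_def by (metis fun_upd_same n_not_Suc_n, metis fun_upd_same fun_upd_other n_not_Suc_n)
  have "ES_apply r c d (ES_diff \<sigma>) x B = (\<Sum>B'\<in>F \<times> Pow {1..r}. x B' * ES_diff \<sigma> B' B)"
    unfolding ES_apply_def
  proof (rule sum.mono_neutral_cong[OF _ finite_ES_basis])
    show "finite (F \<times> Pow {1..r})" by (simp add: F_def)
    show "x B' * ES_diff \<sigma> B' B = 0" if "B' \<in> F \<times> Pow {1..r} - ES_basis r c d" for B'
    proof -
      have "x B' = 0" using x that unfolding ES_chain_def by blast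
      then show ?thesis by simp
    qed
    show "x B' * ES_diff \<sigma> B' B = 0" if B': "B' \<in> ES_basis r c d - F \<times> Pow {1..r}" for B'
    proof -
      obtain u S where uS: "B' = (u, S)" by (cases B')
      with B' have "u \<notin> F" by (auto simp: mem_ES_basis)
      then have "ES_diff \<sigma> (u, S) (v, T) = 0"
        using ES_diff_nonzeroD[of \<alpha> f r c u S v T] unfolding F_def up_def by blast
      then show ?thesis by (simp add: uS B)
    qed
  qed simp
  also have "\<dots> = (\<Sum>u\<in>F. \<Sum>S\<in>Pow {1..r}. x (u, S) * ES_diff \<sigma> (u, S) B)"
    by (simp add: sum.cartesian_product)
  also have "\<dots> = (\<Sum>S\<in>Pow {1..r}. x (v, S) * ES_diff \<sigma> (v, S) B)
      + (\<Sum>i\<in>{1..c}. \<Sum>S\<in>Pow {1..r}. x (up i, S) * ES_diff \<sigma> (up i, S) B)"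
    unfolding F_def using up by (subst sum.insert) (auto simp: sum.reindex inj_on_def)
  also have "\<dots> = D c x B"
    unfolding es_op_eq_sum B
    by (simp add: lift_def shift_def up_def ES_diff_same ES_diff_upd)
  finally show "ES_apply r c d (ES_diff \<sigma>) x B = D c x B" .
qed

lemma ES_diff_degree:
  assumes "B \<in> ES_basis r c d" "ES_diff \<sigma> B B' \<noteq> 0"
  shows "1 \<le> d \<and> B' \<in> ES_basis r c (d - 1) \<and> ES_diff \<sigma> B B' \<in> Qn n"
proof -
  obtain u S v T where B: "B = (u, S)" "B' = (v, T)" by (cases B, cases B')
  with assms have uS: "u \<in> Nc c" "S \<subseteq> {1..r}" "2 * absu c u + card S = d" by (auto simp: mem_ES_basis)
  from assms(2) have nz: "ES_diff \<sigma> (u, S) (v, T) \<noteq> 0" by (simp add: B)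
  show ?thesis using ES_diff_nonzeroD[OF nz]
  proof
    assume u: "u = v"
    with nz have "taylor_diff \<alpha> r S T \<noteq> (0 :: 'k mpoly)" by (simp add: ES_diff_same)
    from taylor_diff_degree[OF this] uS show ?thesis
      unfolding B mem_ES_basis u ES_diff_same using taylor_diff_in_Qn by auto
  next
    assume "\<exists>i\<in>{1..c}. u = v(i := Suc (v i))"
    then obtain i where i: "i \<in> {1..c}" and u: "u = v(i := Suc (v i))" by blast
    with nz have "sigma_e \<alpha> f r i S T \<noteq> 0" by (simp add: ES_diff_upd)
    note deg = sigma_e_degree[OF this]
    have "v \<in> Nc c" "2 * Suc (absu c v) + card S = d"
      using uS(1,3) unfolding u Nc_upd_iff[OF i] absu_upd[OF i] by auto
    with deg sigma_e_in_Qn[OF i, of S T] show ?thesis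
      unfolding B mem_ES_basis u ES_diff_upd[OF i] by auto
  qed
qed

lemma ES_diff_ES_diff:
  assumes d: "2 \<le> d" and B: "B \<in> ES_basis r c d"
  shows "(\<Sum>B''\<in>ES_basis r c (d - 1). ES_diff \<sigma> B B'' * ES_diff \<sigma> B'' B') \<in> \<aa> c"
proof -
  \<comment> \<open>The row of \<open>B\<close> in the squared matrix is the operator applied twice
    to the basis vector of \<open>B\<close>, which brings the claim back to
    \<open>D_D_mem\<close>.\<close>
  define \<delta> :: "'k chain" where "\<delta> = (\<lambda>B'. if B' = B then 1 else 0)"
  have \<delta>: "ES_chain n r c d \<delta>" using B by (simp add: ES_chain_def \<delta>_def)
  have "ES_apply r c d (ES_diff \<sigma>) \<delta> B'' = ES_diff \<sigma> B B''" for B''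
  proof -
    have "ES_apply r c d (ES_diff \<sigma>) \<delta> B'' = (\<Sum>B'\<in>ES_basis r c d. if B' = B then ES_diff \<sigma> B' B'' else 0)"
      unfolding ES_apply_def \<delta>_def by (rule sum.cong) simp_all
    then show ?thesis using B finite_ES_basis by simp
  qed
  then have eq: "D c \<delta> = ES_diff \<sigma> B" using ES_apply_eq[OF \<delta>] by auto
  obtain d' where d': "d = Suc d'" using d by (cases d) auto
  have "ES_chain n r c d' (D c \<delta>)" using \<delta> unfolding d' by (rule D_chain) simp_all
  from ES_apply_eq[OF this] have "ES_apply r c d' (ES_diff \<sigma>) (ES_diff \<sigma> B) B' = D c (D c \<delta>) B'"
    by (simp only: eq)
  also have "\<dots> \<in> \<aa> c"
    by (rule D_D_mem[OF _ ES_chain_supported[OF \<delta>] ES_chain_in_Qn[OF \<delta>]]) simp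
  finally show ?thesis by (simp add: ES_apply_def d')
qed

lemma ES_exact:
  assumes reg: "regular_seq n c a"
    and d: "1 \<le> d" and x: "ES_chain n r c d x" "\<forall>B'. ES_apply r c d (ES_diff \<sigma>) x B' \<in> \<aa> c"
  shows "\<exists>y. ES_chain n r c (d + 1) y \<and> (\<forall>B. ES_apply r c (d + 1) (ES_diff \<sigma>) y B - x B \<in> \<aa> c)"
proof -
  obtain d' where d': "d = Suc d'" using d by (cases d) auto
  have "\<exists>y. ES_chain n r c (Suc (Suc d')) y \<and> (\<forall>B. D c y B - x B \<in> \<aa> c)"
  proof (rule exact[OF _ _ order_refl])
    show "p \<in> gen_ideal n {1..<i} a" if "i \<in> {1..c}" "p \<in> Qn n" "a i * p \<in> gen_ideal n {1..<i} a" for i p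
      using reg that unfolding regular_seq_def by blast
    show "ES_chain n r c (Suc d') x" using x(1) by (simp only: d')
    show "D c x B \<in> \<aa> c" for B using x(2) by (simp only: ES_apply_eq[OF x(1)])
    show "\<exists>Y. (\<forall>S. Y S \<in> Qn n) \<and> (\<forall>S. Y S \<noteq> 0 \<longrightarrow> S \<subseteq> {1..r} \<and> card S = Suc (Suc e)) \<and>
        (\<forall>T. (\<Sum>S\<in>Pow {1..r}. Y S * taylor_diff \<alpha> r S T) = X T)"
      if X: "\<And>S. X S \<in> Qn n" "\<And>S. X S \<noteq> 0 \<Longrightarrow> S \<subseteq> {1..r} \<and> card S = Suc e"
        "\<And>T. (\<Sum>S\<in>Pow {1..r}. X S * taylor_diff \<alpha> r S T) = 0" for e and X :: "nat set \<Rightarrow> 'k mpoly"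
    proof -
      have "1 \<le> Suc e" by simp
      show ?thesis
      proof (rule taylor_acyclic[OF mon \<open>1 \<le> Suc e\<close> X])
        fix Y :: "nat set \<Rightarrow> 'k mpoly"
        assume "\<And>S. Y S \<in> Qn n" "\<And>S. Y S \<noteq> 0 \<Longrightarrow> S \<subseteq> {1..r} \<and> card S = Suc (Suc e)"
          "\<And>T. (\<Sum>S\<in>Pow {1..r}. Y S * taylor_diff \<alpha> r S T) = X T"
        then show ?thesis by (intro exI[of _ Y] conjI allI impI; blast)
      qed
    qed
  qed
  then obtain y where y: "ES_chain n r c (d + 1) y" "\<forall>B. D c y B - x B \<in> \<aa> c"
    unfolding d' Suc_eq_plus1 by blast
  show ?thesis
  proof (intro exI conjI)
    show "\<forall>B. ES_apply r c (d + 1) (ES_diff \<sigma>) y B - x B \<in> \<aa> c"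
      unfolding ES_apply_eq[OF y(1)] by (rule y(2))
  qed (rule y(1))
qed

section \<open>Homology in degree zero\<close>

lemma ES_apply_degree_1:
  assumes y: "ES_chain n r c 1 y"
  shows "ES_apply r c 1 (ES_diff \<sigma>) y ((\<lambda>_. 0), {}) = (\<Sum>j\<in>{1..r}. y (\<lambda>_. 0, {j}) * mono (\<alpha> j))"
proof -
  \<comment> \<open>A divided power variable has degree 2, so a chain of degree 1 has no entry at a
    unit exponent and the homotopies contribute nothing.\<close>
  have "y ((\<lambda>_. 0)(i := Suc 0), S) = 0" if "i \<in> {1..c}" for i S
  proof (rule ccontr)
    assume "y ((\<lambda>_. 0)(i := Suc 0), S) \<noteq> 0"
    then have "2 * absu c ((\<lambda>_. 0)(i := Suc 0)) + card S = 1" using ES_chain_support[OF y] by blast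
    moreover have "absu c ((\<lambda>_. 0)(i := Suc 0)) = Suc (absu c (\<lambda>_. 0))" using absu_upd[OF that, of "\<lambda>_. 0"] by simp
    ultimately show False by simp
  qed
  then have "ES_apply r c 1 (ES_diff \<sigma>) y ((\<lambda>_. 0), {}) = lift r (taylor_diff \<alpha> r) y (\<lambda>_. 0, {})"
    unfolding ES_apply_eq[OF y] es_op_eq_sum by (simp add: shift_def lift_def)
  also have "\<dots> = (\<Sum>t\<in>{1..r} - {}. sg {} t * (y (\<lambda>_. 0, {t}) * mono (lcm_exp \<alpha> {t} - lcm_exp \<alpha> {})))"
    unfolding lift_def fst_conv snd_conv by (rule sum_taylor_diff) simp
  also have "\<dots> = (\<Sum>j\<in>{1..r}. y (\<lambda>_. 0, {j}) * mono (\<alpha> j))"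
  proof -
    have "lcm_exp \<alpha> {t} - lcm_exp \<alpha> {} = \<alpha> t" for t
      by (rule poly_mapping_eqI) (simp add: lookup_minus_expo lookup_lcm_exp_insert)
    then show ?thesis by (simp add: sg_def)
  qed
  finally show ?thesis .
qed

text \<open>The left side is the preimage in Q of the image of the first differential over R, so the
  equality identifies the cokernel with R/I. For an element of the ideal, its coefficients at the
  generators, placed on the singletons, form the required chain.\<close>

lemma ES_augmentation:
  assumes aI: "\<aa> c \<subseteq> gen_ideal n {1..r} (\<lambda>j. mono (\<alpha> j))"
  shows "{p \<in> Qn n. \<exists>y. ES_chain n r c 1 y \<and>
        p - ES_apply r c 1 (ES_diff \<sigma>) y ((\<lambda>_. 0), {}) \<in> \<aa> c} = gen_ideal n {1..r} (\<lambda>j. mono (\<alpha> j))"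
    (is "?L = ?I")
proof
  show "?L \<subseteq> ?I"
  proof
    fix p assume "p \<in> ?L"
    then obtain y where y: "ES_chain n r c 1 y"
      and "p - ES_apply r c 1 (ES_diff \<sigma>) y ((\<lambda>_. 0), {}) \<in> \<aa> c" by blast
    then have p: "p - (\<Sum>j\<in>{1..r}. y (\<lambda>_. 0, {j}) * mono (\<alpha> j)) \<in> \<aa> c"
      by (simp only: ES_apply_degree_1)
    have "(\<Sum>j\<in>{1..r}. y (\<lambda>_. 0, {j}) * mono (\<alpha> j)) \<in> ?I"
      unfolding gen_ideal_def
      by (intro CollectI exI[of _ "\<lambda>j. y (\<lambda>_. 0, {j})"] conjI ballI refl ES_chain_in_Qn[OF y])
    with p aI have "p - (\<Sum>j\<in>{1..r}. y (\<lambda>_. 0, {j}) * mono (\<alpha> j))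
        + (\<Sum>j\<in>{1..r}. y (\<lambda>_. 0, {j}) * mono (\<alpha> j)) \<in> ?I"
      by (intro gen_ideal_add) blast+
    then show "p \<in> ?I" by simp
  qed
  show "?I \<subseteq> ?L"
  proof
    fix p assume p: "p \<in> ?I"
    then obtain h where h: "\<forall>j\<in>{1..r}. h j \<in> Qn n" "p = (\<Sum>j\<in>{1..r}. h j * mono (\<alpha> j))"
      unfolding gen_ideal_def by blast
    define y :: "'k chain" where
      "y B = (if fst B = (\<lambda>_. 0) \<and> (\<exists>j\<in>{1..r}. snd B = {j}) then h (the_elem (snd B)) else 0)" for B
    have y: "ES_chain n r c 1 y"
    proof (rule ES_chainI)
      show "y B \<in> Qn n" for B unfolding y_def using h(1) by auto
      show "u \<in> Nc c \<and> S \<subseteq> {1..r} \<and> 2 * absu c u + card S = 1" if "y (u, S) \<noteq> 0" for u S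
      proof -
        from that have "u = (\<lambda>_. 0) \<and> (\<exists>j\<in>{1..r}. S = {j})"
          unfolding y_def fst_conv snd_conv by (rule contrapos_np) (simp only: if_False)
        then obtain j where "u = (\<lambda>_. 0)" "S = {j}" "j \<in> {1..r}" by blast
        then show ?thesis by (simp add: Nc_def absu_def)
      qed
    qed
    have "(\<Sum>j\<in>{1..r}. y (\<lambda>_. 0, {j}) * mono (\<alpha> j)) = p"
      unfolding h(2) by (rule sum.cong) (auto simp: y_def)
    then have "p - ES_apply r c 1 (ES_diff \<sigma>) y ((\<lambda>_. 0), {}) \<in> \<aa> c"
      unfolding ES_apply_degree_1[OF y] by simp
    moreover have "p \<in> Qn n"
      by (rule gen_ideal_Qn[OF _ p]) (use mon Qn_mono in blast)
    ultimately show "p \<in> ?L" using y by blast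
  qed
qed

end


theorem theorem3p2:
  fixes n r c :: nat
    and \<alpha> :: "nat \<Rightarrow> expo"
    and a :: "nat \<Rightarrow> 'k::field mpoly"
    and f :: "nat \<Rightarrow> nat \<Rightarrow> 'k mpoly"
  defines "I \<equiv> gen_ideal n {1..r} (\<lambda>j. mono (\<alpha> j))"
    and "\<aa> \<equiv> gen_ideal n {1..c} a"
    and "\<sigma> \<equiv> sigma_sys \<alpha> f r c"
    and "\<tau> \<equiv> taylor_diff \<alpha> r"
  assumes mon: "\<forall>j\<in>{1..r}. Poly_Mapping.keys (\<alpha> j) \<subseteq> {..<n}"
    and aQ: "\<forall>i\<in>{1..c}. a i \<in> Qn n"
    and reg: "regular_seq n c a"
    and aI: "\<aa> \<subseteq> I"
    and fQ: "\<forall>i\<in>{1..c}. \<forall>j\<in>{1..r}. f i j \<in> Qn n"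
    and af: "\<forall>i\<in>{1..c}. a i = (\<Sum>j\<in>{1..r}. f i j * mono (\<alpha> j))"
  shows
    \<comment> \<open>(1) a system of higher homotopies on the Taylor complex, and the explicit identities\<close>
    "is_HHS n c a (Pow {1..r}) card \<tau> \<sigma> \<and>
     (\<forall>i\<in>{1..c}. \<forall>S\<in>Pow {1..r}. \<forall>T.
        comp (Pow {1..r}) (sigma_e \<alpha> f r i) (sigma_e \<alpha> f r i) S T = 0) \<and>
     (\<forall>i\<in>{1..c}. \<forall>j\<in>{1..c}. i \<noteq> j \<longrightarrow> (\<forall>S\<in>Pow {1..r}. \<forall>T.
        comp (Pow {1..r}) (sigma_e \<alpha> f r i) (sigma_e \<alpha> f r j) S T
        + comp (Pow {1..r}) (sigma_e \<alpha> f r j) (sigma_e \<alpha> f r i) S T = 0)) \<and>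
     (\<forall>j\<in>{1..c}. \<forall>S\<in>Pow {1..r}. \<forall>T.
        comp (Pow {1..r}) \<tau> (sigma_e \<alpha> f r j) S T + comp (Pow {1..r}) (sigma_e \<alpha> f r j) \<tau> S T
          = (if T = S then a j else 0)) \<and>
    \<comment> \<open>(2) Phi(T) is a free resolution of R/I over R = Q/a\<close>
     (\<forall>dd. \<forall>B\<in>ES_basis r c dd. \<forall>B'. ES_diff \<sigma> B B' \<noteq> 0 \<longrightarrow>
        1 \<le> dd \<and> B' \<in> ES_basis r c (dd - 1) \<and> ES_diff \<sigma> B B' \<in> Qn n) \<and>
     (\<forall>dd\<ge>2. \<forall>B\<in>ES_basis r c dd. \<forall>B'.
        (\<Sum>B''\<in>ES_basis r c (dd - 1). ES_diff \<sigma> B B'' * ES_diff \<sigma> B'' B') \<in> \<aa>) \<and>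
     (\<forall>dd\<ge>1. \<forall>x. ES_chain n r c dd x \<and> (\<forall>B'. ES_apply r c dd (ES_diff \<sigma>) x B' \<in> \<aa>) \<longrightarrow>
        (\<exists>y. ES_chain n r c (dd + 1) y \<and>
             (\<forall>B. ES_apply r c (dd + 1) (ES_diff \<sigma>) y B - x B \<in> \<aa>))) \<and>
     {p \<in> Qn n. \<exists>y. ES_chain n r c 1 y \<and>
        p - ES_apply r c 1 (ES_diff \<sigma>) y ((\<lambda>_. 0), {}) \<in> \<aa>} = I"
proof -
  interpret taylor_homotopies n r c \<alpha> a f
    by (unfold_locales) (fact mon aQ fQ af)+
  show ?thesis
    unfolding I_def \<aa>_def \<sigma>_def \<tau>_def
  proof (intro conjI)
    show "is_HHS n c a (Pow {1..r}) card (taylor_diff \<alpha> r) (sigma_sys \<alpha> f r c)"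
      by (rule is_HHS_sigma_sys)
    show "\<forall>i\<in>{1..c}. \<forall>S\<in>Pow {1..r}. \<forall>T.
        comp (Pow {1..r}) (sigma_e \<alpha> f r i) (sigma_e \<alpha> f r i) S T = 0"
      using comp_sigma_e_self by blast
    show "\<forall>i\<in>{1..c}. \<forall>j\<in>{1..c}. i \<noteq> j \<longrightarrow> (\<forall>S\<in>Pow {1..r}. \<forall>T.
        comp (Pow {1..r}) (sigma_e \<alpha> f r i) (sigma_e \<alpha> f r j) S T
        + comp (Pow {1..r}) (sigma_e \<alpha> f r j) (sigma_e \<alpha> f r i) S T = 0)"
      using comp_sigma_e_anticommute by blast
    show "\<forall>j\<in>{1..c}. \<forall>S\<in>Pow {1..r}. \<forall>T.
        comp (Pow {1..r}) (taylor_diff \<alpha> r) (sigma_e \<alpha> f r j) S T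
        + comp (Pow {1..r}) (sigma_e \<alpha> f r j) (taylor_diff \<alpha> r) S T = (if T = S then a j else 0)"
      using comp_taylor_sigma_eq by blast
    show "\<forall>dd. \<forall>B\<in>ES_basis r c dd. \<forall>B'. ES_diff (sigma_sys \<alpha> f r c) B B' \<noteq> 0 \<longrightarrow>
        1 \<le> dd \<and> B' \<in> ES_basis r c (dd - 1) \<and> ES_diff (sigma_sys \<alpha> f r c) B B' \<in> Qn n"
      using ES_diff_degree by blast
    show "\<forall>dd\<ge>2. \<forall>B\<in>ES_basis r c dd. \<forall>B'. (\<Sum>B''\<in>ES_basis r c (dd - 1).
        ES_diff (sigma_sys \<alpha> f r c) B B'' * ES_diff (sigma_sys \<alpha> f r c) B'' B') \<in> gen_ideal n {1..c} a"
      using ES_diff_ES_diff by blast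
    show "\<forall>dd\<ge>1. \<forall>x. ES_chain n r c dd x \<and>
          (\<forall>B'. ES_apply r c dd (ES_diff (sigma_sys \<alpha> f r c)) x B' \<in> gen_ideal n {1..c} a) \<longrightarrow>
        (\<exists>y. ES_chain n r c (dd + 1) y \<and>
          (\<forall>B. ES_apply r c (dd + 1) (ES_diff (sigma_sys \<alpha> f r c)) y B - x B \<in> gen_ideal n {1..c} a))"
      using ES_exact[OF reg] by blast
    show "{p \<in> Qn n. \<exists>y. ES_chain n r c 1 y \<and>
        p - ES_apply r c 1 (ES_diff (sigma_sys \<alpha> f r c)) y ((\<lambda>_. 0), {}) \<in> gen_ideal n {1..c} a}
      = gen_ideal n {1..r} (\<lambda>j. mono (\<alpha> j))"
      by (rule ES_augmentation) (use aI in \<open>simp only: I_def \<aa>_def\<close>)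
  qed
qed

end
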